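(* Let $n\ge3$ and let $\mathbb{F}^{D}$ be an irreducible representation of the Heisenberg subalgebra $\mathcal{H}_n\subset\mathcal{K}_n$ generated by $H_{i,r}$ ($i\in\mathbb{Z}/n\mathbb{Z}$, $r\ne0$), $K_{i,0}^\pm$ and $C^{\pm1}$, on which $C$ acts as $q^{-1}$. Then with the action $$E_i(z)\mapsto0,\qquad K_i^\pm(z)\mapsto K_i^\pm(z),\qquad C\mapsto q^{-1}\qquad(i\in\mathbb{Z}/n\mathbb{Z}),$$ $\mathbb{F}^{D}$ is an admissible $\mathcal{K}_n$ module.
   Context: **Parameters.** Fix $q^{1/2},d^{1/2}\in\mathbb{C}^\times$, $q_1=q^{-1}d$, $q_2=q^2$, $q_3=q^{-1}d^{-1}$, and assume that $q_1^iq_2^j=1$ ($i,j\in\mathbb{Z}$) implies $i=j=0$. Let $n\ge3$; indices $i,j\in\mathbb{Z}/n\mathbb{Z}$. $\delta(z)=\sum_{k\in\mathbb{Z}}z^k$, $[A,B]_p=AB-pBA$, $\mathrm{Sym}$ is symmetrization (average over permutations of the variables). Put $g_{i,i}(z,w)=z-q^2w$, $g_{i,i\pm1}(z,w)=z-q^{-1}d^{\pm1}w$, $g_{i,j}(z,w)=z-w$ otherwise; $G_{i,i}(x)=q^2\frac{1-q^{-2}x}{1-q^2x}$, $G_{i,i\pm1}(x)=q^{-1}\frac{1-qd^{\pm1}x}{1-q^{-1}d^{\pm1}x}$, $G_{i,j}(x)=1$ otherwise (power series in $x$); $d_{i,j}=d^{\pm1}$ if $i\equiv j\pm1$, $d_{i,j}=1$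 otherwise. **Algebra $\mathcal{K}_n$.** Generated by an invertible central $C$ and the coefficients of $E_i(z)=\sum_kE_{i,k}z^{-k}$, $K_i^\pm(z)=K_{i,0}^\pm\exp\big(\pm(q-q^{-1})\sum_{\pm r>0}H_{i,r}z^{-r}\big)$, with relations (1) $K_i^\pm(z)K_j^\pm(w)=K_j^\pm(w)K_i^\pm(z)$; $K_i^+(z)K_j^-(w)=K_j^-(w)K_i^+(z)G_{i,j}(w/z)G_{i,j}(C^2w/z)$; (2) $K_i^+(z)E_j(w)=E_j(w)K_i^+(z)G_{i,j}(w/z)$; $E_j(w)K_i^-(z)=K_i^-(z)E_j(w)G_{j,i}(z/w)$; (3) $d_{i,j}g_{i,j}(z,w)E_i(z)E_j(w)+g_{j,i}(w,z)E_j(w)E_i(z)=\frac{\delta_{i,j}}{q-q^{-1}}\big(g_{i,i}(z,w)\delta(C^2z/w)K_i^-(z)K_i^+(C^2z)+g_{i,i}(w,z)\delta(C^2w/z)K_i^-(w)K_i^+(C^2w)\big)$; (4) $E_i(z)E_j(w)=E_j(w)E_i(z)$ for $i\not\equiv j,j\pm1$; (5) $\mathrm{Sym}_{z_1,z_2}[E_i(z_1),[E_i(z_2),E_{i\pm1}(w)]_q]_{q^{-1}}=-\mathrm{Sym}_{z_1,z_2}\Big\{\Big(\frac{1}{1-q^{-1}d^{\mp1}z_1/w}+\frac{q^{-1}d^{\pm1}w/z_2}{1-q^{-1}d^{\pm1}w/z_2}\Big)\delta(C^2z_1/z_2)K_i^-(z_1)E_{i\pm1}(w)K_i^+(z_2)\Big\}$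 (expansion in non-negative powers of $z_1/w$, $w/z_2$ respectively). Grading: $\deg E_{i,k}=k$, $\deg H_{i,r}=r$, $\deg K^\pm_{i,0}=\deg C=0$; $\mathcal{K}_n$ is the graded quotient by these relations of the free algebra on the generators completed in the positive direction. **Admissible module.** A $\mathcal{K}_n$ module $V$ is admissible if $C$ is diagonalizable on it and $V$ is $\mathbb{Z}$-graded with finite-dimensional components of degree bounded from above: $V=\oplus_{k=-\infty}^{N}V_k$, $\dim V_k<\infty$.
   Formalization: F^D is assumed Z-graded compatibly with H_n with degrees bounded above, and it is called admissible only if its graded components are finite-dimensional; as stated the claim fails when K_{i,0}^± act invertibly, since K^+_{i,0}K^-_{i,0}=q^4K^-_{i,0}K^+_{i,0}. *)

theory Defs
  imports
    Complex_Main
    "HOL-Computational_Algebra.Formal_Power_Series"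
    "HOL-Algebra.QuotRing"
    "HOL-Algebra.Generated_Rings"
begin

section \<open>Noncommutative formal series in the generators\<close>

text \<open>
  The node set \<open>\<int>/n\<int>\<close> is represented by \<open>{0..<n}\<close>.  \<open>Kp0 i\<close> and \<open>Km0 i\<close> stand for the
  zero modes $K^+_{i,0}$ and $K^-_{i,0}$, and \<open>Cinv\<close> for $C^{-1}$.  There is no generator
  $H_{i,0}$; \<open>valid\<close> excludes the term \<open>H i 0\<close> and indices outside \<open>{0..<n}\<close>.
\<close>

datatype gen = E nat int | H nat int | Kp0 nat | Km0 nat | C | Cinv

fun valid :: "nat \<Rightarrow> gen \<Rightarrow> bool" where
  "valid n (E i k) = (i < n)"
| "valid n (H i r) = (i < n \<and> r \<noteq> 0)"
| "valid n (Kp0 i) = (i < n)"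
| "valid n (Km0 i) = (i < n)"
| "valid n C = True"
| "valid n Cinv = True"

fun gdeg :: "gen \<Rightarrow> int" where
  "gdeg (E i k) = k"
| "gdeg (H i r) = r"
| "gdeg (Kp0 i) = 0"
| "gdeg (Km0 i) = 0"
| "gdeg C = 0"
| "gdeg Cinv = 0"

definition wdeg :: "gen list \<Rightarrow> int" where
  "wdeg w = sum_list (map gdeg w)"

text \<open>All formal series in words over \<open>gen\<close>, with the concatenation product.\<close>

typedef ser = "UNIV :: (gen list \<Rightarrow> complex) set"
  morphisms coef Ser ..

lemma coef_Ser [simp]: "coef (Ser f) = f"
  by (simp add: Ser_inverse)

lemma ser_eqI: "(\<And>w. coef f w = coef g w) \<Longrightarrow> f = g"
  by (metis coef_inject ext)

instantiation ser :: ring_1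
begin

definition "0 = Ser (\<lambda>w. 0)"
definition "1 = Ser (\<lambda>w. if w = [] then 1 else 0)"
definition "f + g = Ser (\<lambda>w. coef f w + coef g w)"
definition "f - g = Ser (\<lambda>w. coef f w - coef g w)"
definition "- f = Ser (\<lambda>w. - coef f w)"
definition "f * g = Ser (\<lambda>w. \<Sum>k\<le>length w. coef f (take k w) * coef g (drop k w))"

lemma coef_simps [simp]:
  "coef 0 w = 0"
  "coef 1 w = (if w = [] then 1 else 0)"
  "coef (f + g) w = coef f w + coef g w"
  "coef (f - g) w = coef f w - coef g w"
  "coef (- f) w = - coef f w"
  by (simp_all add: zero_ser_def one_ser_def plus_ser_def minus_ser_def uminus_ser_def)

lemma coef_mult:
  "coef (f * g) w = (\<Sum>k\<le>length w. coef f (take k w) * coef g (drop k w))"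
  by (simp add: times_ser_def)

instance
proof
  fix a b c :: ser
  show "a * b * c = a * (b * c)"
  proof (rule ser_eqI)
    fix w
    let ?t = "\<lambda>j k. coef a (take j w) * coef b (take k (drop j w)) * coef c (drop (j + k) w)"
    have "coef (a * b * c) w = (\<Sum>m\<le>length w. \<Sum>j\<le>m. ?t j (m - j))"
      unfolding coef_mult sum_distrib_right
    proof (rule sum.cong[OF refl], rule sum.cong)
      fix m x assume m: "m \<in> {..length w}"
      then show "{..length (take m w)} = {..m}" by auto
      assume "x \<in> {..m}"
      then show "coef a (take x (take m w)) * coef b (drop x (take m w)) * coef c (drop m w)
          = ?t x (m - x)"
        by (simp add: min_def drop_take)
    qed
    also have "\<dots> = (\<Sum>(j, k)\<in>{(j, k). j + k \<le> length w}. ?t j k)"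
      by (rule sum.triangle_reindex_eq[symmetric])
    also have "{(j, k). j + k \<le> length w} = (SIGMA j:{..length w}. {..length w - j})"
      by auto
    also have "(\<Sum>(j, k)\<in>(SIGMA j:{..length w}. {..length w - j}). ?t j k)
        = (\<Sum>j\<le>length w. \<Sum>k\<le>length w - j. ?t j k)"
      by (rule sum.Sigma[symmetric]) auto
    also have "\<dots> = coef (a * (b * c)) w"
      unfolding coef_mult sum_distrib_left
      by (intro sum.cong) (auto simp: mult.assoc add.commute)
    finally show "coef (a * b * c) w = coef (a * (b * c)) w" .
  qed
  show "1 * a = a"
  proof (rule ser_eqI)
    fix w
    have "coef (1 * a) w = (\<Sum>k\<le>length w. if k = 0 then coef a w else 0)"
      unfolding coef_mult by (intro sum.cong) auto
    then show "coef (1 * a) w = coef a w" by simp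
  qed
  show "a * 1 = a"
  proof (rule ser_eqI)
    fix w
    have "coef (a * 1) w = (\<Sum>k\<le>length w. if k = length w then coef a w else 0)"
      unfolding coef_mult by (intro sum.cong) auto
    then show "coef (a * 1) w = coef a w" by simp
  qed
  show "(a + b) * c = a * c + b * c"
    by (rule ser_eqI) (simp add: coef_mult distrib_right sum.distrib)
  show "a * (b + c) = a * b + a * c"
    by (rule ser_eqI) (simp add: coef_mult distrib_left sum.distrib)
  have "coef (0 :: ser) [] \<noteq> coef 1 []" by simp
  then show "(0 :: ser) \<noteq> 1" by metis
qed (rule ser_eqI; simp)+

end

definition scal :: "complex \<Rightarrow> ser" where
  "scal c = Ser (\<lambda>w. if w = [] then c else 0)"

definition letter :: "gen \<Rightarrow> ser" where
  "letter x = Ser (\<lambda>w. if w = [x] then 1 else 0)"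

text \<open>
  Sum of an infinite family, computed word by word; in every use below each word occurs in
  only finitely many members of the family.
\<close>

definition fsum :: "('b \<Rightarrow> ser) \<Rightarrow> ser" where
  "fsum F = Ser (\<lambda>w. \<Sum>b | coef (F b) w \<noteq> 0. coef (F b) w)"


section \<open>The free algebra completed in the positive direction\<close>

text \<open>
  Let \<open>A\<close> be the free algebra on the valid generators, graded by \<open>wdeg\<close>.  The degree \<open>k\<close>
  component of the completion consists of the convergent series $\sum_{s \ge M} f_s g_s$ with
  $\deg g_s = s$ and $\deg f_s + s = k$, i.e. it is the inverse limit over \<open>m\<close> of the
  degree \<open>k\<close> components of $A / A A_{\ge m}$.  As $A A_{\ge m}$ is spanned by the words having
  a suffix of degree at least \<open>m\<close>, this is the set of series of degree \<open>k\<close> that for each \<open>m\<close>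
  contain only finitely many words all of whose suffixes have degree less than \<open>m\<close>.
  \<open>nbhd n m\<close> is the closure of $A A_{\ge m}$; these sets are the basic neighbourhoods of \<open>0\<close>.
\<close>

definition supp :: "ser \<Rightarrow> gen list set" where
  "supp f = {w. coef f w \<noteq> 0}"

definition cfree_set :: "nat \<Rightarrow> ser set" where
  "cfree_set n = {f.
     (\<forall>w\<in>supp f. \<forall>x\<in>set w. valid n x) \<and>
     finite (wdeg ` supp f) \<and>
     (\<forall>m. finite {w\<in>supp f. \<forall>k\<le>length w. wdeg (drop k w) < m})}"

definition cfree :: "nat \<Rightarrow> ser ring" where
  "cfree n = \<lparr>carrier = cfree_set n, mult = (*), one = 1, zero = 0, add = (+)\<rparr>"

definition nbhd :: "nat \<Rightarrow> int \<Rightarrow> ser set" where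
  "nbhd n m = {f\<in>cfree_set n. \<forall>w\<in>supp f. \<exists>k\<le>length w. wdeg (drop k w) \<ge> m}"


section \<open>Structure functions and currents\<close>

definition nxt :: "nat \<Rightarrow> nat \<Rightarrow> nat" where
  "nxt n i = (i + 1) mod n"

text \<open>\<open>gpar n q d i j\<close> is the number $\gamma_{i,j}$ with $g_{i,j}(z,w) = z - \gamma_{i,j} w$.\<close>

definition gpar :: "nat \<Rightarrow> complex \<Rightarrow> complex \<Rightarrow> nat \<Rightarrow> nat \<Rightarrow> complex" where
  "gpar n q d i j =
     (if i = j then q^2
      else if j = nxt n i then inverse q * d
      else if i = nxt n j then inverse q * inverse d
      else 1)"

definition dpar :: "nat \<Rightarrow> complex \<Rightarrow> nat \<Rightarrow> nat \<Rightarrow> complex" where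
  "dpar n d i j = (if i = nxt n j then d else if j = nxt n i then inverse d else 1)"

definition Gser :: "nat \<Rightarrow> complex \<Rightarrow> complex \<Rightarrow> nat \<Rightarrow> nat \<Rightarrow> complex fps" where
  "Gser n q d i j =
     (if i = j then
        fps_const (q^2) * (1 - fps_const (inverse q^2) * fps_X)
          * inverse (1 - fps_const (q^2) * fps_X)
      else if j = nxt n i then
        fps_const (inverse q) * (1 - fps_const (q * d) * fps_X)
          * inverse (1 - fps_const (inverse q * d) * fps_X)
      else if i = nxt n j then
        fps_const (inverse q) * (1 - fps_const (q * inverse d) * fps_X)
          * inverse (1 - fps_const (inverse q * inverse d) * fps_X)
      else 1)"

definition Cpow :: "int \<Rightarrow> ser" where
  "Cpow k = (if k \<ge> 0 then letter C ^ nat k else letter Cinv ^ nat (- k))"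

definition Gcoef :: "nat \<Rightarrow> complex \<Rightarrow> complex \<Rightarrow> nat \<Rightarrow> nat \<Rightarrow> nat \<Rightarrow> ser" where
  "Gcoef n q d i j c = scal (fps_nth (Gser n q d i j) c)"

text \<open>Coefficient of \<open>x^c\<close> in $G_{i,j}(x) G_{i,j}(C^2 x)$.\<close>

definition GGcoef :: "nat \<Rightarrow> complex \<Rightarrow> complex \<Rightarrow> nat \<Rightarrow> nat \<Rightarrow> nat \<Rightarrow> ser" where
  "GGcoef n q d i j c =
     (\<Sum>k\<le>c. scal (fps_nth (Gser n q d i j) (c - k) * fps_nth (Gser n q d i j) k) * Cpow (2 * int k))"

text \<open>\<open>exp\<close> of a power series with zero constant term.\<close>

definition fexp :: "ser fps \<Rightarrow> ser fps" where
  "fexp A = Abs_fps (\<lambda>m. \<Sum>k\<le>m. scal (1 / fact k) * fps_nth (A ^ k) m)"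

text \<open>
  Formal distributions are given by their coefficients: \<open>Ecur i a\<close>, \<open>Kp q i a\<close>, \<open>Km q i a\<close> are
  the coefficients of $z^a$ in $E_i(z)$, $K_i^+(z)$, $K_i^-(z)$.  Thus $E_{i,k}$ is
  \<open>Ecur i (-k)\<close>; $K_i^+(z)$ is a power series in $z^{-1}$ and $K_i^-(z)$ one in $z$.
\<close>

definition Ecur :: "nat \<Rightarrow> int \<Rightarrow> ser" where
  "Ecur i a = letter (E i (- a))"

definition Kp :: "complex \<Rightarrow> nat \<Rightarrow> int \<Rightarrow> ser" where
  "Kp q i a = (if a \<le> 0 then
     letter (Kp0 i) *
     fps_nth (fexp (Abs_fps (\<lambda>r. if r = 0 then 0
                                 else scal (q - inverse q) * letter (H i (int r))))) (nat (- a))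
     else 0)"

definition Km :: "complex \<Rightarrow> nat \<Rightarrow> int \<Rightarrow> ser" where
  "Km q i a = (if a \<ge> 0 then
     letter (Km0 i) *
     fps_nth (fexp (Abs_fps (\<lambda>r. if r = 0 then 0
                                 else scal (- (q - inverse q)) * letter (H i (- int r))))) (nat a)
     else 0)"

text \<open>Coefficient of \<open>z^p\<close> in $K_i^-(z) K_i^+(C^2 z)$.\<close>

definition KK :: "complex \<Rightarrow> nat \<Rightarrow> int \<Rightarrow> ser" where
  "KK q i p = fsum (\<lambda>c::nat. Km q i (p + int c) * Kp q i (- int c) * Cpow (- 2 * int c))"

text \<open>
  Coefficients of \<open>z^a w^b\<close> in $\delta(C^2 z/w) K_i^-(z) K_i^+(C^2 z)$ and in
  $\delta(C^2 w/z) K_i^-(w) K_i^+(C^2 w)$.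
\<close>

definition delta_KK1 :: "complex \<Rightarrow> nat \<Rightarrow> int \<Rightarrow> int \<Rightarrow> ser" where
  "delta_KK1 q i a b = Cpow (- 2 * b) * KK q i (a + b)"

definition delta_KK2 :: "complex \<Rightarrow> nat \<Rightarrow> int \<Rightarrow> int \<Rightarrow> ser" where
  "delta_KK2 q i a b = Cpow (- 2 * a) * KK q i (a + b)"

definition pcomm :: "complex \<Rightarrow> ser \<Rightarrow> ser \<Rightarrow> ser" where
  "pcomm p A B = A * B - scal p * B * A"

text \<open>Coefficient of $z_1^a z_2^b w^c$ in $[E_i(z_1), [E_i(z_2), E_j(w)]_q]_{q^{-1}}$.\<close>

definition serreL :: "complex \<Rightarrow> nat \<Rightarrow> nat \<Rightarrow> int \<Rightarrow> int \<Rightarrow> int \<Rightarrow> ser" where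
  "serreL q i j a b c = pcomm (inverse q) (Ecur i a) (pcomm q (Ecur i b) (Ecur j c))"

text \<open>
  Coefficient of $z_1^a z_2^b w^c$ in $\delta(C^2 z_1/z_2) K_i^-(z_1) E_j(w) K_i^+(z_2)$.
\<close>

definition delta_KEK :: "complex \<Rightarrow> nat \<Rightarrow> nat \<Rightarrow> int \<Rightarrow> int \<Rightarrow> int \<Rightarrow> ser" where
  "delta_KEK q i j a b c =
     fsum (\<lambda>k::int. Cpow (2 * k) * Km q i (a - k) * Ecur j c * Kp q i (b + k))"

text \<open>
  Coefficient of $z_1^a z_2^b w^c$ in
  $\big(\frac{1}{1 - q^{-1} e^{-1} z_1/w} + \frac{q^{-1} e w/z_2}{1 - q^{-1} e w/z_2}\big)
   \delta(C^2 z_1/z_2) K_i^-(z_1) E_j(w) K_i^+(z_2)$, where \<open>e\<close> is $d^{\pm1}$ for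
  $j = i \pm 1$.
\<close>

definition serreR :: "complex \<Rightarrow> complex \<Rightarrow> nat \<Rightarrow> nat \<Rightarrow> int \<Rightarrow> int \<Rightarrow> int \<Rightarrow> ser" where
  "serreR q e i j a b c =
     fsum (\<lambda>m::nat. scal ((inverse q * inverse e) ^ m)
                      * delta_KEK q i j (a - int m) b (c + int m)) +
     fsum (\<lambda>m::nat. scal ((inverse q * e) ^ Suc m)
                      * delta_KEK q i j a (b + int (Suc m)) (c - int (Suc m)))"

definition Sym2 :: "(int \<Rightarrow> int \<Rightarrow> int \<Rightarrow> ser) \<Rightarrow> int \<Rightarrow> int \<Rightarrow> int \<Rightarrow> ser" where
  "Sym2 F a b c = scal (1 / 2) * (F a b c + F b a c)"


section \<open>The algebra\<close>

text \<open>Left-hand side minus right-hand side of each coefficient of each defining relation.\<close>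

inductive_set rels :: "nat \<Rightarrow> complex \<Rightarrow> complex \<Rightarrow> ser set" for n q d where
  C_Cinv: "letter C * letter Cinv - 1 \<in> rels n q d"
| Cinv_C: "letter Cinv * letter C - 1 \<in> rels n q d"
| C_central: "valid n x \<Longrightarrow> letter C * letter x - letter x * letter C \<in> rels n q d"
| KpKp: "i < n \<Longrightarrow> j < n \<Longrightarrow> Kp q i a * Kp q j b - Kp q j b * Kp q i a \<in> rels n q d"
| KmKm: "i < n \<Longrightarrow> j < n \<Longrightarrow> Km q i a * Km q j b - Km q j b * Km q i a \<in> rels n q d"
| KpKm: "i < n \<Longrightarrow> j < n \<Longrightarrow>
    Kp q i a * Km q j b
      - fsum (\<lambda>c::nat. Km q j (b - int c) * Kp q i (a + int c) * GGcoef n q d i j c)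
    \<in> rels n q d"
| KpE: "i < n \<Longrightarrow> j < n \<Longrightarrow>
    Kp q i a * Ecur j b
      - fsum (\<lambda>c::nat. Ecur j (b - int c) * Kp q i (a + int c) * Gcoef n q d i j c)
    \<in> rels n q d"
| EKm: "i < n \<Longrightarrow> j < n \<Longrightarrow>
    Ecur j b * Km q i a
      - fsum (\<lambda>c::nat. Km q i (a - int c) * Ecur j (b + int c) * Gcoef n q d j i c)
    \<in> rels n q d"
| EE: "i < n \<Longrightarrow> j < n \<Longrightarrow>
    scal (dpar n d i j)
        * (Ecur i (a - 1) * Ecur j b - scal (gpar n q d i j) * Ecur i a * Ecur j (b - 1))
      + (Ecur j (b - 1) * Ecur i a - scal (gpar n q d j i) * Ecur j b * Ecur i (a - 1))
      - (if i = j then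
           scal (1 / (q - inverse q)) *
             ((delta_KK1 q i (a - 1) b - scal (gpar n q d i i) * delta_KK1 q i a (b - 1))
              + (delta_KK2 q i a (b - 1) - scal (gpar n q d i i) * delta_KK2 q i (a - 1) b))
         else 0)
    \<in> rels n q d"
| EE_far: "i < n \<Longrightarrow> j < n \<Longrightarrow> i \<noteq> j \<Longrightarrow> j \<noteq> nxt n i \<Longrightarrow> i \<noteq> nxt n j \<Longrightarrow>
    Ecur i a * Ecur j b - Ecur j b * Ecur i a \<in> rels n q d"
| Serre_up: "i < n \<Longrightarrow> j = nxt n i \<Longrightarrow>
    Sym2 (serreL q i j) a b c + Sym2 (serreR q d i j) a b c \<in> rels n q d"
| Serre_down: "j < n \<Longrightarrow> i = nxt n j \<Longrightarrow>
    Sym2 (serreL q i j) a b c + Sym2 (serreR q (inverse d) i j) a b c \<in> rels n q d"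

text \<open>
  \<open>K_alg n q d\<close> is $\mathcal{K}_n$: the quotient of the completed free algebra by the smallest
  closed two-sided ideal containing the relations.  (Closedness makes \<open>C\<close> commute with
  infinite series and lets relations be used inside convergent sums.)  The parameters \<open>q\<close>
  and \<open>d\<close> are the squares of the fixed $q^{1/2}$ and $d^{1/2}$.
\<close>

definition closed_ideal :: "nat \<Rightarrow> ser set \<Rightarrow> bool" where
  "closed_ideal n I \<longleftrightarrow> ideal I (cfree n) \<and>
     (\<forall>f\<in>carrier (cfree n). (\<forall>m. \<exists>g\<in>I. f - g \<in> nbhd n m) \<longrightarrow> f \<in> I)"

definition K_ideal :: "nat \<Rightarrow> complex \<Rightarrow> complex \<Rightarrow> ser set" where
  "K_ideal n q d = \<Inter>{I. closed_ideal n I \<and> rels n q d \<subseteq> I}"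

definition K_alg :: "nat \<Rightarrow> complex \<Rightarrow> complex \<Rightarrow> ser set ring" where
  "K_alg n q d = cfree n Quot K_ideal n q d"

definition cls :: "nat \<Rightarrow> complex \<Rightarrow> complex \<Rightarrow> ser \<Rightarrow> ser set" where
  "cls n q d f = K_ideal n q d +>\<^bsub>cfree n\<^esub> f"

text \<open>Homogeneous elements of degree \<open>k\<close>.\<close>

definition K_deg :: "nat \<Rightarrow> complex \<Rightarrow> complex \<Rightarrow> int \<Rightarrow> ser set set" where
  "K_deg n q d k = {cls n q d f | f. f \<in> carrier (cfree n) \<and> (\<forall>w\<in>supp f. wdeg w = k)}"

text \<open>
  The (uncompleted) Heisenberg subalgebra of \<open>K_alg n q d\<close>; the scalars are included to obtain
  a subalgebra over the complex numbers and not just a subring.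
\<close>

definition H_alg :: "nat \<Rightarrow> complex \<Rightarrow> complex \<Rightarrow> ser set set" where
  "H_alg n q d = generate_ring (K_alg n q d)
     (cls n q d ` (range scal
        \<union> {letter (H i r) | i r. i < n \<and> r \<noteq> 0}
        \<union> {letter (Kp0 i) | i. i < n} \<union> {letter (Km0 i) | i. i < n}
        \<union> {letter C, letter Cinv}))"


section \<open>Representations\<close>

text \<open>
  The representation space is a complex vector space: a type \<open>'v\<close> with scalar
  multiplication \<open>scale\<close> (assumed to satisfy \<open>vector_space scale\<close>).
  \<open>S\<close> is the carrier of a subalgebra of \<open>K_alg n q d\<close>.
\<close>

definition subalg_rep ::
  "nat \<Rightarrow> complex \<Rightarrow> complex \<Rightarrow> (complex \<Rightarrow> 'v::ab_group_add \<Rightarrow> 'v) \<Rightarrow> ser set set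
    \<Rightarrow> (ser set \<Rightarrow> 'v \<Rightarrow> 'v) \<Rightarrow> bool" where
  "subalg_rep n q d scale S \<rho> \<longleftrightarrow>
     (\<forall>x\<in>S. Vector_Spaces.linear scale scale (\<rho> x)) \<and>
     (\<forall>c v. \<rho> (cls n q d (scal c)) v = scale c v) \<and>
     (\<forall>x\<in>S. \<forall>y\<in>S. \<forall>v. \<rho> (x \<oplus>\<^bsub>K_alg n q d\<^esub> y) v = \<rho> x v + \<rho> y v) \<and>
     (\<forall>x\<in>S. \<forall>y\<in>S. \<forall>v. \<rho> (x \<otimes>\<^bsub>K_alg n q d\<^esub> y) v = \<rho> x (\<rho> y v))"

definition irreducible_rep ::
  "(complex \<Rightarrow> 'v::ab_group_add \<Rightarrow> 'v) \<Rightarrow> ser set set \<Rightarrow> (ser set \<Rightarrow> 'v \<Rightarrow> 'v) \<Rightarrow> bool" where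
  "irreducible_rep scale S \<rho> \<longleftrightarrow>
     (\<exists>v::'v. v \<noteq> 0) \<and>
     (\<forall>W. module.subspace scale W \<and> (\<forall>x\<in>S. \<forall>v\<in>W. \<rho> x v \<in> W) \<longrightarrow> W = {0} \<or> W = UNIV)"

text \<open>
  A module over the topological algebra \<open>K_alg n q d\<close>: the action is continuous for the discrete
  topology on \<open>'v\<close>, so that infinite series act through finitely many of their terms on each
  vector and the action is determined by that of the generators.
\<close>

definition K_module ::
  "nat \<Rightarrow> complex \<Rightarrow> complex \<Rightarrow> (complex \<Rightarrow> 'v::ab_group_add \<Rightarrow> 'v)
    \<Rightarrow> (ser set \<Rightarrow> 'v \<Rightarrow> 'v) \<Rightarrow> bool" where
  "K_module n q d scale \<sigma> \<longleftrightarrow>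
     subalg_rep n q d scale (carrier (K_alg n q d)) \<sigma> \<and>
     (\<forall>v. \<exists>m. \<forall>f\<in>nbhd n m. \<sigma> (cls n q d f) v = 0)"

definition grading :: "(complex \<Rightarrow> 'v::ab_group_add \<Rightarrow> 'v) \<Rightarrow> (int \<Rightarrow> 'v set) \<Rightarrow> bool" where
  "grading scale V \<longleftrightarrow>
     (\<forall>k. module.subspace scale (V k)) \<and>
     (\<forall>v. \<exists>!c. (\<forall>k. c k \<in> V k) \<and> finite {k. c k \<noteq> 0} \<and> v = (\<Sum>k | c k \<noteq> 0. c k))"

definition graded_action ::
  "nat \<Rightarrow> complex \<Rightarrow> complex \<Rightarrow> ser set set \<Rightarrow> (ser set \<Rightarrow> 'v \<Rightarrow> 'v) \<Rightarrow> (int \<Rightarrow> 'v set) \<Rightarrow> bool"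
  where
  "graded_action n q d S \<rho> V \<longleftrightarrow>
     (\<forall>k l. \<forall>x\<in>S \<inter> K_deg n q d k. \<forall>v\<in>V l. \<rho> x v \<in> V (k + l))"

definition bounded_above :: "(int \<Rightarrow> 'v::zero set) \<Rightarrow> bool" where
  "bounded_above V \<longleftrightarrow> (\<exists>N. \<forall>k>N. V k = {0})"

definition fin_dim :: "(complex \<Rightarrow> 'v::ab_group_add \<Rightarrow> 'v) \<Rightarrow> 'v set \<Rightarrow> bool" where
  "fin_dim scale W \<longleftrightarrow> (\<exists>B. finite B \<and> W = module.span scale B)"

definition diagonalizable ::
  "(complex \<Rightarrow> 'v::ab_group_add \<Rightarrow> 'v) \<Rightarrow> ('v \<Rightarrow> 'v) \<Rightarrow> bool" where
  "diagonalizable scale T \<longleftrightarrow> module.span scale {v. \<exists>c. T v = scale c v} = UNIV"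

definition admissible ::
  "nat \<Rightarrow> complex \<Rightarrow> complex \<Rightarrow> (complex \<Rightarrow> 'v::ab_group_add \<Rightarrow> 'v)
    \<Rightarrow> (ser set \<Rightarrow> 'v \<Rightarrow> 'v) \<Rightarrow> bool" where
  "admissible n q d scale \<sigma> \<longleftrightarrow>
     K_module n q d scale \<sigma> \<and>
     diagonalizable scale (\<sigma> (cls n q d (letter C))) \<and>
     (\<exists>V. grading scale V \<and> graded_action n q d (carrier (K_alg n q d)) \<sigma> V \<and>
          bounded_above V \<and> (\<forall>k. fin_dim scale (V k)))"

end

theory Submission
  imports Defs
begin

text \<open>
  Let the letters \<open>E\<close> act by zero and the other letters through the given representation of the
  Heisenberg subalgebra.  Three points have to be settled.

  \<^item> An element of the completed free algebra must act on each vector.  The representation space is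
    graded with degrees bounded above, so a word with a suffix of large degree kills a given vector
    (\<open>kills_from_exists\<close>), and by definition of the completion a series has only finitely many other
    words.  The resulting action is multiplicative (\<open>ser_act_mult\<close>), and its kernel is a closed
    two-sided ideal (\<open>closed_ideal_annihilator\<close>).

  \<^item> This kernel must contain the defining relations (\<open>rels_annihilate\<close>); then it contains the closed
    ideal that they generate, and the action descends to the quotient.  Relations without \<open>E\<close> hold in
    the given representation.  The Serre relations, the relations between \<open>K\<close> and \<open>E\<close> and those between
    two different currents \<open>E\<close> have a letter \<open>E\<close> in every word, on both sides.  What is left is the
    relation between $E_i(z)$ and $E_i(w)$: its right side must vanish, and it does
    exactly because $C = q^{-1}$, as $(z - q^2 w)\delta(q^{-2} z / w) = 0$
    (\<open>ser_act_EE_rhs\<close>).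

  \<^item> The relations involve infinite sums, and it must be shown that they belong to the completed free
    algebra at all (\<open>rels_subset_cfree\<close>).  The reason is always that, for every bound, all but
    finitely many of the nonzero terms end in a factor of degree above it.

  On the Heisenberg subalgebra, which consists of the classes of polynomials in its generators
  (\<open>H_alg_eq\<close>), the new action is the given one (\<open>ser_act_heis\<close>).  Homogeneity of the action is checked
  word by word.
\<close>

section \<open>Supports of series\<close>

lemma supp_zero [simp]: "supp 0 = {}"
  and supp_one [simp]: "supp 1 = {[]}"
  and supp_letter [simp]: "supp (letter x) = {[x]}"
  and supp_uminus [simp]: "supp (- f) = supp f"
  by (auto simp: supp_def letter_def)

lemma supp_scal: "supp (scal c) \<subseteq> {[]}"
  by (auto simp: supp_def scal_def)

lemma supp_add: "supp (f + g) \<subseteq> supp f \<union> supp g"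
  and supp_diff: "supp (f - g) \<subseteq> supp f \<union> supp g"
  by (auto simp: supp_def)

lemma supp_mult: "supp (f * g) \<subseteq> {u @ v | u v. u \<in> supp f \<and> v \<in> supp g}"
proof
  fix w assume "w \<in> supp (f * g)"
  then obtain k where "coef f (take k w) * coef g (drop k w) \<noteq> 0"
    unfolding supp_def coef_mult by (metis (mono_tags, lifting) mem_Collect_eq sum.neutral)
  then have "w = take k w @ drop k w" "take k w \<in> supp f" "drop k w \<in> supp g"
    by (auto simp: supp_def)
  then show "w \<in> {u @ v | u v. u \<in> supp f \<and> v \<in> supp g}" by blast
qed

lemma supp_multE:
  assumes "w \<in> supp (f * g)"
  obtains u v where "w = u @ v" "u \<in> supp f" "v \<in> supp g"
  using assms supp_mult by blast

lemma supp_fsum: "supp (fsum F) \<subseteq> (\<Union>b. supp (F b))"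
proof
  fix w assume "w \<in> supp (fsum F)"
  then have "(\<Sum>b | coef (F b) w \<noteq> 0. coef (F b) w) \<noteq> 0"
    by (simp add: supp_def fsum_def)
  then obtain b where "coef (F b) w \<noteq> 0" by (meson sum.neutral)
  then show "w \<in> (\<Union>b. supp (F b))" by (auto simp: supp_def)
qed

lemma supp_scal_mult: "supp (scal c * f) \<subseteq> supp f"
  using supp_scal by (fastforce elim!: supp_multE)

lemma coef_sum: "coef (sum F S) w = (\<Sum>b\<in>S. coef (F b) w)"
  by (induction S rule: infinite_finite_induct) auto

text \<open>
  The constant \<open>fsum\<close> gives a nonzero value at a word only if finitely many members of the family
  contain it, so replacing it by a finite sum needs an argument; for supports, the inclusion
  \<open>supp_fsum\<close> holds in every case.
\<close>

lemma fsum_finite: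
  assumes "finite S" "\<And>b. b \<notin> S \<Longrightarrow> F b = 0"
  shows "fsum F = sum F S"
proof (rule ser_eqI)
  fix w
  have "(\<Sum>b | coef (F b) w \<noteq> 0. coef (F b) w) = (\<Sum>b\<in>S. coef (F b) w)"
  proof (rule sum.mono_neutral_left)
    show "{b. coef (F b) w \<noteq> 0} \<subseteq> S" using assms(2) by fastforce
  qed (use assms in auto)
  then show "coef (fsum F) w = coef (sum F S) w"
    by (simp add: fsum_def coef_sum)
qed

lemma scal_0: "scal 0 = 0" and scal_1: "scal 1 = 1"
  by (rule ser_eqI, simp add: scal_def)+

lemma coef_scal_mult: "coef (scal c * f) w = c * coef f w"
proof -
  have "coef (scal c * f) w = (\<Sum>k\<le>length w. if k = 0 then c * coef f w else 0)"
    unfolding coef_mult by (intro sum.cong) (auto simp: scal_def)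
  then show ?thesis by simp
qed

lemma wdeg_simps [simp]:
  "wdeg [] = 0" "wdeg (x # w) = gdeg x + wdeg w" "wdeg (u @ v) = wdeg u + wdeg v"
  by (simp_all add: wdeg_def)

subsection \<open>Homogeneous series\<close>

definition homog :: "int \<Rightarrow> ser \<Rightarrow> bool" where
  "homog k f \<longleftrightarrow> (\<forall>w\<in>supp f. wdeg w = k)"

lemma homog_zero [simp]: "homog k 0"
  by (simp add: homog_def)

lemma homog_scal [simp]: "homog 0 (scal c)"
  using supp_scal by (fastforce simp: homog_def)

lemma homog_one [simp]: "homog 0 1"
  by (simp add: homog_def)

lemma homog_letter: "homog (gdeg x) (letter x)"
  by (simp add: homog_def)

lemma homog_add: "homog k f \<Longrightarrow> homog k g \<Longrightarrow> homog k (f + g)"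
  using supp_add by (fastforce simp: homog_def)

lemma homog_mult: "homog k f \<Longrightarrow> homog l g \<Longrightarrow> homog (k + l) (f * g)"
  by (auto simp: homog_def elim!: supp_multE)

lemma homog_scal_mult: "homog k f \<Longrightarrow> homog k (scal c * f)"
  using homog_mult[OF homog_scal] by force

lemma homog_sum: "(\<And>b. b \<in> S \<Longrightarrow> homog k (F b)) \<Longrightarrow> homog k (sum F S)"
  by (induction S rule: infinite_finite_induct) (auto intro: homog_add)

text \<open>
  The sign \<open>e\<close> is \<open>1\<close> for the modes \<open>H i r\<close> of $K^+$ and \<open>-1\<close> for the modes \<open>H i (-r)\<close> of $K^-$;
  in both cases the coefficient of the \<open>m\<close>-th power of the formal variable has degree \<open>e m\<close>.
\<close>

lemma homog_fexp:
  assumes "\<And>m. homog (e * int m) (fps_nth A m)"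
  shows "homog (e * int m) (fps_nth (fexp A) m)"
proof -
  have pow: "homog (e * int m) (fps_nth (A ^ k) m)" for k m
  proof (induction k arbitrary: m)
    case 0
    then show ?case by (cases m) (auto simp: homog_def)
  next
    case (Suc k)
    have "homog (e * int j + e * int (m - j)) (fps_nth A j * fps_nth (A ^ k) (m - j))"
      if "j \<le> m" for j
      using assms Suc that by (intro homog_mult)
    then have "homog (e * int m) (fps_nth A j * fps_nth (A ^ k) (m - j))" if "j \<le> m" for j
      using that by (simp add: algebra_simps of_nat_diff)
    then show ?case by (auto simp: fps_mult_nth intro!: homog_sum)
  qed
  then show ?thesis
    by (auto simp: fexp_def intro!: homog_sum homog_scal_mult)
qed

section \<open>The completed free algebra\<close>

text \<open>
  A word is applied to a vector from its right end, so the degrees of its suffixes are the degree shifts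
  that occur while it acts.  A word not satisfying this predicate reaches degree at least \<open>m\<close> on the way;
  these are the words that vanish in the quotient by $A A_{\ge m}$.
\<close>

definition suffixes_below :: "int \<Rightarrow> gen list \<Rightarrow> bool" where
  "suffixes_below m w \<longleftrightarrow> (\<forall>k\<le>length w. wdeg (drop k w) < m)"

lemma suffixes_below_iff: "suffixes_below m w \<longleftrightarrow> (\<forall>u v. w = u @ v \<longrightarrow> wdeg v < m)"
proof
  assume *: "suffixes_below m w"
  show "\<forall>u v. w = u @ v \<longrightarrow> wdeg v < m"
  proof (intro allI impI)
    fix u v assume "w = u @ v"
    then show "wdeg v < m" using *[unfolded suffixes_below_def, rule_format, of "length u"] by simp
  qed
next
  assume "\<forall>u v. w = u @ v \<longrightarrow> wdeg v < m"
  then show "suffixes_below m w" unfolding suffixes_below_def by (metis append_take_drop_id)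
qed

lemma suffixes_below_append:
  "suffixes_below m (u @ v) \<longleftrightarrow> suffixes_below (m - wdeg v) u \<and> suffixes_below m v"
proof
  assume *: "suffixes_below m (u @ v)"
  have "wdeg t < m" if "v = s @ t" for s t
    using * that unfolding suffixes_below_iff by (metis append.assoc)
  moreover have "wdeg t < m - wdeg v" if "u = s @ t" for s t
    using *[unfolded suffixes_below_iff, rule_format, of s "t @ v"] that by simp
  ultimately show "suffixes_below (m - wdeg v) u \<and> suffixes_below m v"
    by (simp add: suffixes_below_iff)
next
  assume *: "suffixes_below (m - wdeg v) u \<and> suffixes_below m v"
  show "suffixes_below m (u @ v)"
    unfolding suffixes_below_iff
  proof (intro allI impI)
    fix s t assume "u @ v = s @ t"
    then consider r where "u = s @ r" "t = r @ v" | r where "v = r @ t"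
      by (auto simp: append_eq_append_conv2)
    then show "wdeg t < m"
    proof cases
      case 1
      then have "wdeg r < m - wdeg v" using * unfolding suffixes_below_iff by blast
      then show ?thesis using 1 by simp
    next
      case 2
      then show ?thesis using * unfolding suffixes_below_iff by blast
    qed
  qed
qed

lemma suffixes_below_wdeg: "suffixes_below m w \<Longrightarrow> wdeg w < m"
  unfolding suffixes_below_iff by (metis append_Nil)

lemma suffixes_below_mono: "suffixes_below m w \<Longrightarrow> m \<le> m' \<Longrightarrow> suffixes_below m' w"
  unfolding suffixes_below_def by fastforce

lemma cfree_set_iff:
  "f \<in> cfree_set n \<longleftrightarrow> (\<forall>w\<in>supp f. \<forall>x\<in>set w. valid n x) \<and> finite (wdeg ` supp f) \<and>
     (\<forall>m. finite {w\<in>supp f. suffixes_below m w})"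
  by (simp add: cfree_set_def suffixes_below_def)

lemma nbhd_iff: "f \<in> nbhd n m \<longleftrightarrow> f \<in> cfree_set n \<and> (\<forall>w\<in>supp f. \<not> suffixes_below m w)"
  by (auto simp: nbhd_def suffixes_below_def not_less)

lemma cfree_set_finite: "f \<in> cfree_set n \<Longrightarrow> finite {w\<in>supp f. suffixes_below m w}"
  by (simp add: cfree_set_iff)

lemma cfree_set_subsupp:
  assumes "f \<in> cfree_set n" "g \<in> cfree_set n" "supp h \<subseteq> supp f \<union> supp g"
  shows "h \<in> cfree_set n"
  unfolding cfree_set_iff
proof (intro conjI allI)
  show "\<forall>w\<in>supp h. \<forall>x\<in>set w. valid n x"
    using assms by (auto simp: cfree_set_iff)
  have "wdeg ` supp h \<subseteq> wdeg ` supp f \<union> wdeg ` supp g" using assms(3) by blast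
  then show "finite (wdeg ` supp h)"
    using assms(1,2) by (meson cfree_set_iff finite_UnI finite_subset)
  fix m
  have "{w\<in>supp h. suffixes_below m w}
      \<subseteq> {w\<in>supp f. suffixes_below m w} \<union> {w\<in>supp g. suffixes_below m w}"
    using assms(3) by blast
  then show "finite {w\<in>supp h. suffixes_below m w}"
    by (rule finite_subset) (use assms(1,2) in \<open>auto intro: cfree_set_finite\<close>)
qed

text \<open>
  Below the cutoff \<open>m\<close> there are finitely many right factors \<open>v\<close>; once \<open>v\<close> is chosen, the left factor
  must stay below \<open>m - wdeg v\<close>, which again leaves finitely many.
\<close>

lemma cfree_set_mult:
  assumes f: "f \<in> cfree_set n" and g: "g \<in> cfree_set n"
  shows "f * g \<in> cfree_set n"
  unfolding cfree_set_iff
proof (intro conjI allI ballI)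
  fix w x assume "w \<in> supp (f * g)" "x \<in> set w"
  then show "valid n x" using f g by (auto simp: cfree_set_iff elim!: supp_multE)
next
  have "wdeg ` supp (f * g) \<subseteq> (\<lambda>(k, l). k + l) ` (wdeg ` supp f \<times> wdeg ` supp g)"
    by (force elim!: supp_multE)
  then show "finite (wdeg ` supp (f * g))"
    using f g by (meson cfree_set_iff finite_SigmaI finite_imageI finite_subset)
next
  fix m
  let ?B = "{v\<in>supp g. suffixes_below m v}"
  let ?A = "\<lambda>v. {u\<in>supp f. suffixes_below (m - wdeg v) u}"
  have "{w\<in>supp (f * g). suffixes_below m w} \<subseteq> (\<Union>v\<in>?B. (\<lambda>u. u @ v) ` ?A v)"
    by (auto simp: suffixes_below_append elim!: supp_multE)
  moreover have "finite (\<Union>v\<in>?B. (\<lambda>u. u @ v) ` ?A v)"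
    using f g by (auto intro!: cfree_set_finite)
  ultimately show "finite {w\<in>supp (f * g). suffixes_below m w}"
    by (rule finite_subset)
qed

definition poly_set :: "nat \<Rightarrow> ser set" where
  "poly_set n = {f. finite (supp f) \<and> (\<forall>w\<in>supp f. \<forall>x\<in>set w. valid n x)}"

lemma poly_set_cfree: "f \<in> poly_set n \<Longrightarrow> f \<in> cfree_set n"
  by (auto simp: poly_set_def cfree_set_iff)

lemma poly_set_scal: "scal c \<in> poly_set n"
  using supp_scal[of c] finite_subset by (fastforce simp: poly_set_def)

lemma poly_set_letter: "valid n x \<Longrightarrow> letter x \<in> poly_set n"
  by (simp add: poly_set_def)

lemma poly_set_mult: "f \<in> poly_set n \<Longrightarrow> g \<in> poly_set n \<Longrightarrow> f * g \<in> poly_set n"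
proof -
  assume f: "f \<in> poly_set n" and g: "g \<in> poly_set n"
  have "supp (f * g) \<subseteq> (\<lambda>(u, v). u @ v) ` (supp f \<times> supp g)"
    by (force elim!: supp_multE)
  then have "finite (supp (f * g))"
    using f g by (auto simp: poly_set_def dest: finite_subset)
  then show ?thesis
    using f g by (auto simp: poly_set_def elim!: supp_multE)
qed

lemma poly_set_add: "f \<in> poly_set n \<Longrightarrow> g \<in> poly_set n \<Longrightarrow> f + g \<in> poly_set n"
  using supp_add[of f g] by (auto simp: poly_set_def dest: finite_subset)

lemma cfree_set_zero: "0 \<in> cfree_set n" and cfree_set_one: "1 \<in> cfree_set n"
  using poly_set_cfree[OF poly_set_scal[of 0]] poly_set_cfree[OF poly_set_scal[of 1]]
  by (simp_all add: scal_0 scal_1)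

lemma cfree_set_scal: "scal c \<in> cfree_set n"
  by (rule poly_set_cfree[OF poly_set_scal])

lemma cfree_set_letter: "valid n x \<Longrightarrow> letter x \<in> cfree_set n"
  by (rule poly_set_cfree[OF poly_set_letter])

lemma cfree_set_add: "f \<in> cfree_set n \<Longrightarrow> g \<in> cfree_set n \<Longrightarrow> f + g \<in> cfree_set n"
  and cfree_set_diff: "f \<in> cfree_set n \<Longrightarrow> g \<in> cfree_set n \<Longrightarrow> f - g \<in> cfree_set n"
  by (erule cfree_set_subsupp, assumption, rule supp_add supp_diff)+

lemma cfree_set_uminus: "f \<in> cfree_set n \<Longrightarrow> - f \<in> cfree_set n"
  using cfree_set_diff[OF cfree_set_zero] by simp

lemma cfree_simps [simp]:
  "carrier (cfree n) = cfree_set n" "f \<otimes>\<^bsub>cfree n\<^esub> g = f * g" "f \<oplus>\<^bsub>cfree n\<^esub> g = f + g"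
  "\<zero>\<^bsub>cfree n\<^esub> = 0" "\<one>\<^bsub>cfree n\<^esub> = 1"
  by (simp_all add: cfree_def)

lemma ring_cfree: "ring (cfree n)"
proof (rule ringI)
  show "abelian_group (cfree n)"
  proof (rule abelian_groupI)
    fix x assume "x \<in> carrier (cfree n)"
    then show "\<exists>y\<in>carrier (cfree n). y \<oplus>\<^bsub>cfree n\<^esub> x = \<zero>\<^bsub>cfree n\<^esub>"
      by (intro bexI[of _ "- x"]) (auto intro: cfree_set_uminus)
  qed (auto intro: cfree_set_add cfree_set_zero simp: ac_simps)
  show "Group.monoid (cfree n)"
    by (rule monoidI) (auto intro: cfree_set_mult cfree_set_one simp: mult.assoc)
qed (auto simp: distrib_left distrib_right)

lemma a_inv_cfree: "f \<in> cfree_set n \<Longrightarrow> \<ominus>\<^bsub>cfree n\<^esub> f = - f"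
proof -
  interpret R: ring "cfree n" by (rule ring_cfree)
  assume "f \<in> cfree_set n"
  then show ?thesis
    using R.minus_equality[of "- f" f] by (simp add: cfree_set_uminus)
qed

lemma ideal_cfreeI:
  assumes sub: "I \<subseteq> cfree_set n" and zero: "0 \<in> I"
    and diff: "\<And>f g. f \<in> I \<Longrightarrow> g \<in> I \<Longrightarrow> f - g \<in> I"
    and mult: "\<And>f g. f \<in> I \<Longrightarrow> g \<in> cfree_set n \<Longrightarrow> g * f \<in> I \<and> f * g \<in> I"
  shows "ideal I (cfree n)"
proof (rule idealI[OF ring_cfree])
  interpret R: ring "cfree n" by (rule ring_cfree)
  have uminus: "- f \<in> I" if "f \<in> I" for f using diff[OF zero that] by simp
  have add: "f + g \<in> I" if "f \<in> I" "g \<in> I" for f g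
    using diff[OF that(1) uminus[OF that(2)]] by simp
  show "subgroup I (add_monoid (cfree n))"
    by (rule R.add.subgroupI)
      (use sub zero add uminus in \<open>auto simp: a_inv_def[symmetric] a_inv_cfree subset_iff\<close>)
qed (use mult in auto)

lemma closed_ideal_carrier: "closed_ideal n (cfree_set n)"
  by (auto simp: closed_ideal_def intro!: ideal_cfreeI
      intro: cfree_set_zero cfree_set_diff cfree_set_mult)

subsection \<open>Series assembled from infinitely many polynomials\<close>

text \<open>
  All infinite sums in the relations have this form: homogeneous polynomials of one common degree such
  that, for every bound, all but finitely many of the nonzero ones end in a factor of degree above it.
\<close>

lemma cfree_set_family:
  assumes supp: "supp f \<subseteq> (\<Union>b. supp (F b))"
    and poly: "\<And>b. F b \<in> poly_set n"
    and homog: "\<And>b. homog k (F b)"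
    and fin: "\<And>m. finite {b. \<exists>w\<in>supp (F b). suffixes_below m w}"
  shows "f \<in> cfree_set n"
  unfolding cfree_set_iff
proof (intro conjI allI)
  show "\<forall>w\<in>supp f. \<forall>x\<in>set w. valid n x"
    using supp poly by (fastforce simp: poly_set_def)
  have "wdeg ` supp f \<subseteq> {k}"
    using supp homog by (fastforce simp: homog_def)
  then show "finite (wdeg ` supp f)"
    by (rule finite_subset) simp
  fix m
  have "{w\<in>supp f. suffixes_below m w} \<subseteq> (\<Union>b\<in>{b. \<exists>w\<in>supp (F b). suffixes_below m w}. supp (F b))"
    using supp by blast
  then show "finite {w\<in>supp f. suffixes_below m w}"
    by (rule finite_subset) (use poly fin in \<open>auto simp: poly_set_def\<close>)
qed

text \<open>
  This provides the finiteness hypothesis of \<open>cfree_set_family\<close>: the degree of a right factor is bounded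
  by the cutoff.
\<close>

lemma suffixes_below_homog_right:
  assumes "w \<in> supp (f * g)" "homog e g" "suffixes_below m w"
  shows "e < m"
proof -
  obtain u v where w: "w = u @ v" "v \<in> supp g" using assms(1) by (elim supp_multE)
  then have "suffixes_below m v" using assms(3) by (simp add: suffixes_below_append)
  then show ?thesis using suffixes_below_wdeg w(2) assms(2) by (auto simp: homog_def)
qed

section \<open>The Heisenberg polynomials\<close>

text \<open>
  The uncompleted free algebra on the generators of the Heisenberg subalgebra, whose classes are exactly
  the elements of \<open>H_alg\<close>.
\<close>

inductive_set heis_poly :: "nat \<Rightarrow> ser set" for n where
  scal: "scal c \<in> heis_poly n"
| letter: "valid n x \<Longrightarrow> (\<And>i k. x \<noteq> E i k) \<Longrightarrow> letter x \<in> heis_poly n"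
| add: "f \<in> heis_poly n \<Longrightarrow> g \<in> heis_poly n \<Longrightarrow> f + g \<in> heis_poly n"
| mult: "f \<in> heis_poly n \<Longrightarrow> g \<in> heis_poly n \<Longrightarrow> f * g \<in> heis_poly n"

lemma heis_poly_poly: "f \<in> heis_poly n \<Longrightarrow> f \<in> poly_set n"
  by (induction rule: heis_poly.induct)
    (auto intro: poly_set_scal poly_set_letter poly_set_add poly_set_mult)

lemma heis_poly_zero: "0 \<in> heis_poly n" and heis_poly_one: "1 \<in> heis_poly n"
  using heis_poly.scal[of 0] heis_poly.scal[of 1] by (simp_all add: scal_0 scal_1)

lemma heis_poly_uminus: "f \<in> heis_poly n \<Longrightarrow> - f \<in> heis_poly n"
proof -
  assume "f \<in> heis_poly n"
  then have "scal (-1) * f \<in> heis_poly n" by (intro heis_poly.mult heis_poly.scal)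
  moreover have "scal (-1) * f = - f" by (rule ser_eqI) (simp add: coef_scal_mult)
  ultimately show ?thesis by simp
qed

lemma heis_poly_diff: "f \<in> heis_poly n \<Longrightarrow> g \<in> heis_poly n \<Longrightarrow> f - g \<in> heis_poly n"
  using heis_poly.add[OF _ heis_poly_uminus] by force

lemma heis_poly_sum: "(\<And>b. b \<in> S \<Longrightarrow> F b \<in> heis_poly n) \<Longrightarrow> sum F S \<in> heis_poly n"
  by (induction S rule: infinite_finite_induct) (auto intro: heis_poly_zero heis_poly.add)

lemma heis_poly_power: "f \<in> heis_poly n \<Longrightarrow> f ^ k \<in> heis_poly n"
  by (induction k) (auto intro: heis_poly_one heis_poly.mult)

lemma heis_poly_fexp:
  assumes "\<And>m. fps_nth A m \<in> heis_poly n"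
  shows "fps_nth (fexp A) m \<in> heis_poly n"
proof -
  have "fps_nth (A ^ k) m \<in> heis_poly n" for k m
  proof (induction k arbitrary: m)
    case 0
    then show ?case by (cases m) (auto intro: heis_poly_zero heis_poly_one)
  next
    case (Suc k)
    then show ?case using assms by (auto simp: fps_mult_nth intro!: heis_poly_sum heis_poly.mult)
  qed
  then show ?thesis
    by (auto simp: fexp_def intro!: heis_poly_sum heis_poly.mult heis_poly.scal)
qed

lemma heis_poly_Cpow: "Cpow k \<in> heis_poly n"
  by (auto simp: Cpow_def intro!: heis_poly_power heis_poly.letter)

lemma heis_poly_Kp: "i < n \<Longrightarrow> Kp q i a \<in> heis_poly n"
  and heis_poly_Km: "i < n \<Longrightarrow> Km q i a \<in> heis_poly n"
  by (auto simp: Kp_def Km_def intro!: heis_poly_zero heis_poly.mult heis_poly.letter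
      heis_poly.scal heis_poly_fexp)

lemma heis_poly_GGcoef: "GGcoef n q d i j c \<in> heis_poly n"
  unfolding GGcoef_def by (intro heis_poly_sum heis_poly.mult heis_poly.scal heis_poly_Cpow)

lemma homog_power: "homog 0 f \<Longrightarrow> homog 0 (f ^ k)"
  by (induction k) (use homog_mult[of 0 f 0] in auto)

lemma homog_Cpow: "homog 0 (Cpow k)"
  using homog_letter[of C] homog_letter[of Cinv] by (auto simp: Cpow_def intro!: homog_power)

lemma homog_Kp: "homog (- a) (Kp q i a)"
proof (cases "a \<le> 0")
  case True
  let ?A = "Abs_fps (\<lambda>r. if r = 0 then 0 else scal (q - inverse q) * letter (H i (int r)))"
  have "homog (1 * int m) (fps_nth ?A m)" for m
    using homog_letter[of "H i (int m)"] by (auto intro: homog_scal_mult)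
  then have "homog (0 + 1 * int (nat (- a))) (letter (Kp0 i) * fps_nth (fexp ?A) (nat (- a)))"
    using homog_letter[of "Kp0 i"] by (intro homog_mult homog_fexp) simp_all
  then show ?thesis using True by (simp add: Kp_def)
qed (simp add: Kp_def)

lemma homog_Km: "homog (- a) (Km q i a)"
proof (cases "a \<ge> 0")
  case True
  let ?A = "Abs_fps (\<lambda>r. if r = 0 then 0 else scal (- (q - inverse q)) * letter (H i (- int r)))"
  have "homog (- 1 * int m) (fps_nth ?A m)" for m
    using homog_letter[of "H i (- int m)"] by (auto intro: homog_scal_mult simp del: minus_diff_eq)
  then have "homog (0 + - 1 * int (nat a)) (letter (Km0 i) * fps_nth (fexp ?A) (nat a))"
    using homog_letter[of "Km0 i"] by (intro homog_mult homog_fexp) simp_all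
  then show ?thesis using True by (simp add: Km_def)
qed (simp add: Km_def)

lemma homog_Ecur: "homog (- a) (Ecur j a)"
  using homog_letter[of "E j (- a)"] by (simp add: Ecur_def)

lemma Kp_eq_0: "a > 0 \<Longrightarrow> Kp q i a = 0" and Km_eq_0: "a < 0 \<Longrightarrow> Km q i a = 0"
  by (simp_all add: Kp_def Km_def)

section \<open>The defining relations lie in the completed free algebra\<close>

lemma cfree_set_heis: "f \<in> heis_poly n \<Longrightarrow> f \<in> cfree_set n"
  by (rule poly_set_cfree[OF heis_poly_poly])

lemma poly_set_Ecur: "i < n \<Longrightarrow> Ecur i a \<in> poly_set n"
  by (simp add: Ecur_def poly_set_letter)

lemmas poly_set_currents = poly_set_Ecur heis_poly_poly[OF heis_poly_Kp]
  heis_poly_poly[OF heis_poly_Km] heis_poly_poly[OF heis_poly_Cpow] poly_set_scal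

text \<open>
  Since $K^+$ is a series in $z^{-1}$ and $K^-$ a series in $z$, only finitely many terms of the quadratic
  relations with a structure function are nonzero.
\<close>

lemma fsum_KpKm:
  "fsum (\<lambda>c::nat. Km q j (b - int c) * Kp q i (a + int c) * f c)
    = (\<Sum>c\<in>{..nat b}. Km q j (b - int c) * Kp q i (a + int c) * f c)"
  by (rule fsum_finite) (auto simp: Km_eq_0)

lemma fsum_KpE:
  "fsum (\<lambda>c::nat. Ecur j (b - int c) * Kp q i (a + int c) * f c)
    = (\<Sum>c\<in>{..nat (- a)}. Ecur j (b - int c) * Kp q i (a + int c) * f c)"
  by (rule fsum_finite) (auto simp: Kp_eq_0)

lemma fsum_EKm:
  "fsum (\<lambda>c::nat. Km q i (a - int c) * Ecur j (b + int c) * f c)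
    = (\<Sum>c\<in>{..nat a}. Km q i (a - int c) * Ecur j (b + int c) * f c)"
  by (rule fsum_finite) (auto simp: Km_eq_0)

text \<open>
  The \<open>c\<close>-th term ends in $K^+_{-c}$ times a power of \<open>Cinv\<close>, a factor of degree \<open>c\<close>.
\<close>

lemma cfree_set_KK:
  assumes "i < n"
  shows "KK q i p \<in> cfree_set n"
proof (rule cfree_set_family)
  let ?F = "\<lambda>c::nat. Km q i (p + int c) * Kp q i (- int c) * Cpow (- 2 * int c)"
  show "supp (KK q i p) \<subseteq> (\<Union>c. supp (?F c))"
    unfolding KK_def by (rule supp_fsum)
  show "?F c \<in> poly_set n" for c
    using assms by (intro poly_set_mult poly_set_currents)
  show "homog (- p) (?F c)" for c
  proof -
    have "homog (- (p + int c) + - (- int c) + 0) (?F c)"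
      by (intro homog_mult homog_Km homog_Kp homog_Cpow)
    then show ?thesis by simp
  qed
  fix m
  have "int c < m" if "w \<in> supp (?F c)" "suffixes_below m w" for c w
  proof -
    have "homog (int c) (Kp q i (- int c) * Cpow (- 2 * int c))"
      using homog_mult[OF homog_Kp[of "- int c" q i] homog_Cpow[of "- 2 * int c"]] by simp
    then show ?thesis
      using that suffixes_below_homog_right by (metis mult.assoc)
  qed
  then have "{c. \<exists>w\<in>supp (?F c). suffixes_below m w} \<subseteq> {..nat m}" by force
  then show "finite {c. \<exists>w\<in>supp (?F c). suffixes_below m w}"
    by (rule finite_subset) simp
qed

text \<open>
  Both summands are double sums over \<open>m\<close> (expansion of the rational function) and \<open>k\<close> (the delta
  function).  Nonvanishing of $K^-$ and $K^+$ bounds \<open>k\<close> from above and \<open>m\<close> in terms of \<open>k\<close>; the suffix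
  starting at $K^+$ in the first sum, and at \<open>E\<close> in the second, bounds \<open>k\<close> from below.
\<close>

lemma cfree_set_serreR:
  assumes ij: "i < n" "j < n"
  shows "serreR q e i j a b c \<in> cfree_set n"
  unfolding serreR_def
proof (rule cfree_set_add)
  have fl: "supp (fsum (\<lambda>m::nat. scal (s m) * fsum (F m))) \<subseteq> (\<Union>x. supp ((\<lambda>(m, k). F m k) x))"
    for s :: "nat \<Rightarrow> complex" and F :: "nat \<Rightarrow> int \<Rightarrow> ser"
  proof
    fix w assume "w \<in> supp (fsum (\<lambda>m. scal (s m) * fsum (F m)))"
    then obtain m where "w \<in> supp (scal (s m) * fsum (F m))" using supp_fsum by fast
    then obtain k where "w \<in> supp (F m k)" using supp_scal_mult supp_fsum by fast
    then show "w \<in> (\<Union>x. supp ((\<lambda>(m, k). F m k) x))" by (intro UN_I[of "(m, k)"]) auto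
  qed
  let ?F = "\<lambda>(m::nat, k). Cpow (2 * k) * Km q i (a - int m - k) * Ecur j (c + int m) * Kp q i (b + k)"
  show "fsum (\<lambda>m::nat. scal ((inverse q * inverse e) ^ m) * delta_KEK q i j (a - int m) b (c + int m))
      \<in> cfree_set n"
  proof (rule cfree_set_family)
    show "supp (fsum (\<lambda>m::nat. scal ((inverse q * inverse e) ^ m) * delta_KEK q i j (a - int m) b (c + int m)))
      \<subseteq> (\<Union>x. supp (?F x))"
      unfolding delta_KEK_def by (rule fl)
    show "?F x \<in> poly_set n" for x
      using ij by (auto split: prod.split intro!: poly_set_mult poly_set_currents)
    have "homog (- (a + b + c)) (Cpow (2 * k) * Km q i (a - int m - k) * Ecur j (c + int m) * Kp q i (b + k))"
      for m k
    proof -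
      have "homog (0 + - (a - int m - k) + - (c + int m) + - (b + k))
          (Cpow (2 * k) * Km q i (a - int m - k) * Ecur j (c + int m) * Kp q i (b + k))"
        by (intro homog_mult homog_Cpow homog_Km homog_Ecur homog_Kp)
      moreover have "0 + - (a - int m - k) + - (c + int m) + - (b + k) = - (a + b + c)" by simp
      ultimately show ?thesis by metis
    qed
    then show "homog (- (a + b + c)) (?F x)" for x by (cases x) simp
    fix M
    have "k \<in> {- b - M..- b} \<and> m \<in> {..nat (a + b + M)}"
      if w: "w \<in> supp (?F (m, k))" "suffixes_below M w" for m k w
    proof -
      have "- (b + k) < M" using w suffixes_below_homog_right homog_Kp by fastforce
      moreover have "Km q i (a - int m - k) \<noteq> 0" "Kp q i (b + k) \<noteq> 0" using w(1) by auto
      then have "a - int m - k \<ge> 0" "b + k \<le> 0" using Km_eq_0 Kp_eq_0 by force+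
      ultimately show ?thesis by auto
    qed
    then have "x \<in> {..nat (a + b + M)} \<times> {- b - M..- b}" if "\<exists>w\<in>supp (?F x). suffixes_below M w" for x
      using that by (cases x) blast
    then have "{x. \<exists>w\<in>supp (?F x). suffixes_below M w} \<subseteq> {..nat (a + b + M)} \<times> {- b - M..- b}"
      by blast
    then show "finite {x. \<exists>w\<in>supp (?F x). suffixes_below M w}"
      by (rule finite_subset) simp
  qed
  let ?G = "\<lambda>(m::nat, k). Cpow (2 * k) * Km q i (a - k) * Ecur j (c - int (Suc m))
    * Kp q i (b + int (Suc m) + k)"
  show "fsum (\<lambda>m::nat. scal ((inverse q * e) ^ Suc m)
      * delta_KEK q i j a (b + int (Suc m)) (c - int (Suc m))) \<in> cfree_set n"
  proof (rule cfree_set_family)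
    show "supp (fsum (\<lambda>m::nat. scal ((inverse q * e) ^ Suc m)
      * delta_KEK q i j a (b + int (Suc m)) (c - int (Suc m)))) \<subseteq> (\<Union>x. supp (?G x))"
      unfolding delta_KEK_def by (rule fl)
    show "?G x \<in> poly_set n" for x
      using ij by (auto split: prod.split intro!: poly_set_mult poly_set_currents)
    have "homog (- (a + b + c)) (Cpow (2 * k) * Km q i (a - k) * Ecur j (c - int (Suc m))
        * Kp q i (b + int (Suc m) + k))" for m k
    proof -
      have "homog (0 + - (a - k) + - (c - int (Suc m)) + - (b + int (Suc m) + k))
          (Cpow (2 * k) * Km q i (a - k) * Ecur j (c - int (Suc m)) * Kp q i (b + int (Suc m) + k))"
        by (intro homog_mult homog_Cpow homog_Km homog_Ecur homog_Kp)
      moreover have "0 + - (a - k) + - (c - int (Suc m)) + - (b + int (Suc m) + k) = - (a + b + c)"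
        by simp
      ultimately show ?thesis by metis
    qed
    then show "homog (- (a + b + c)) (?G x)" for x by (cases x) simp
    fix M
    have "k \<in> {- b - c - M..a} \<and> m \<in> {..nat (c + M)}"
      if w: "w \<in> supp (?G (m, k))" "suffixes_below M w" for m k w
    proof -
      have "homog (- b - c - k) (Ecur j (c - int (Suc m)) * Kp q i (b + int (Suc m) + k))"
        using homog_mult[OF homog_Ecur[of "c - int (Suc m)" j] homog_Kp[of "b + int (Suc m) + k" q i]]
        by (simp add: algebra_simps)
      then have "- b - c - k < M"
        using w suffixes_below_homog_right
        by (metis (no_types, lifting) case_prod_conv mult.assoc)
      moreover have "Km q i (a - k) \<noteq> 0" "Kp q i (b + int (Suc m) + k) \<noteq> 0" using w(1) by auto
      then have "a - k \<ge> 0" "b + int (Suc m) + k \<le> 0" using Km_eq_0 Kp_eq_0 by force+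
      ultimately show ?thesis by auto
    qed
    then have "x \<in> {..nat (c + M)} \<times> {- b - c - M..a}" if "\<exists>w\<in>supp (?G x). suffixes_below M w" for x
      using that by (cases x) blast
    then have "{x. \<exists>w\<in>supp (?G x). suffixes_below M w} \<subseteq> {..nat (c + M)} \<times> {- b - c - M..a}"
      by blast
    then show "finite {x. \<exists>w\<in>supp (?G x). suffixes_below M w}"
      by (rule finite_subset) simp
  qed
qed

lemma cfree_set_sum: "(\<And>b. b \<in> S \<Longrightarrow> F b \<in> cfree_set n) \<Longrightarrow> sum F S \<in> cfree_set n"
  by (induction S rule: infinite_finite_induct) (auto intro: cfree_set_zero cfree_set_add)

text \<open>
  Without this inclusion no ideal would contain the relations and \<open>K_ideal\<close> would be the intersection
  of an empty family.
\<close>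

lemma rels_subset_cfree: "rels n q d \<subseteq> cfree_set n"
proof
  have nxt: "nxt n i < n" if "i < n" for i
    using that by (simp add: nxt_def)
  note heis = heis_poly_Kp heis_poly_Km heis_poly_Cpow heis_poly_GGcoef
  note closed = cfree_set_add cfree_set_diff cfree_set_mult cfree_set_scal cfree_set_one
    cfree_set_zero cfree_set_letter cfree_set_sum cfree_set_KK cfree_set_serreR
    poly_set_cfree[OF poly_set_Ecur] heis[THEN cfree_set_heis]
  fix f assume "f \<in> rels n q d"
  then show "f \<in> cfree_set n"
    by cases
      (use nxt in \<open>auto simp: fsum_KpKm fsum_KpE fsum_EKm Gcoef_def delta_KK1_def delta_KK2_def
        Sym2_def serreL_def pcomm_def intro!: closed\<close>)
qed

section \<open>The quotient\<close>

lemma closed_ideal_K_ideal: "closed_ideal n (K_ideal n q d)"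
proof -
  interpret R: ring "cfree n" by (rule ring_cfree)
  let ?S = "{I. closed_ideal n I \<and> rels n q d \<subseteq> I}"
  have "cfree_set n \<in> ?S" using closed_ideal_carrier rels_subset_cfree by blast
  then have "ideal (\<Inter>?S) (cfree n)"
    by (intro R.i_Intersect) (auto simp: closed_ideal_def)
  moreover have "f \<in> I"
    if "f \<in> carrier (cfree n)" "\<forall>m. \<exists>g\<in>\<Inter>?S. f - g \<in> nbhd n m" "I \<in> ?S" for f I
    using that unfolding closed_ideal_def by blast
  ultimately show ?thesis unfolding K_ideal_def closed_ideal_def[of n "\<Inter>?S"] by blast
qed

lemma ideal_K_ideal: "ideal (K_ideal n q d) (cfree n)"
  using closed_ideal_K_ideal by (simp add: closed_ideal_def)

lemma K_ideal_least: "closed_ideal n I \<Longrightarrow> rels n q d \<subseteq> I \<Longrightarrow> K_ideal n q d \<subseteq> I"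
  unfolding K_ideal_def by blast

lemma rels_subset_K_ideal: "rels n q d \<subseteq> K_ideal n q d"
  unfolding K_ideal_def by blast

lemma cls_hom:
  assumes "f \<in> cfree_set n" "g \<in> cfree_set n"
  shows "cls n q d (f + g) = cls n q d f \<oplus>\<^bsub>K_alg n q d\<^esub> cls n q d g"
    and "cls n q d (f * g) = cls n q d f \<otimes>\<^bsub>K_alg n q d\<^esub> cls n q d g"
  using ring_hom_memE(2,3)[OF ideal.rcos_ring_hom[OF ideal_K_ideal[of n q d]]] assms
  by (simp_all add: cls_def K_alg_def)

lemma cls_one: "cls n q d 1 = \<one>\<^bsub>K_alg n q d\<^esub>"
  using ring_hom_memE(4)[OF ideal.rcos_ring_hom[OF ideal_K_ideal[of n q d]]]
  by (simp add: cls_def K_alg_def)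

lemma cls_uminus:
  assumes "f \<in> cfree_set n"
  shows "cls n q d (- f) = \<ominus>\<^bsub>K_alg n q d\<^esub> cls n q d f"
proof -
  interpret ring_hom_ring "cfree n" "K_alg n q d" "cls n q d"
    unfolding cls_def[abs_def] K_alg_def by (rule ideal.rcos_ring_hom_ring[OF ideal_K_ideal])
  show ?thesis using hom_a_inv[of f] assms by (simp add: a_inv_cfree)
qed

lemma carrier_K_alg: "carrier (K_alg n q d) = cls n q d ` cfree_set n"
  by (auto simp: K_alg_def FactRing_def A_RCOSETS_def' cls_def)

lemma cls_eqD:
  assumes "f \<in> cfree_set n" "g \<in> cfree_set n" "cls n q d f = cls n q d g"
  shows "f - g \<in> K_ideal n q d"
proof -
  interpret ideal "K_ideal n q d" "cfree n" by (rule ideal_K_ideal)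
  have "f \<in> cls n q d g" using a_rcos_self[of f] assms by (simp add: cls_def)
  then show ?thesis by (auto simp: cls_def a_r_coset_def')
qed

lemma cls_K_ideal: "f \<in> K_ideal n q d \<Longrightarrow> cls n q d f = cls n q d 0"
proof -
  assume f: "f \<in> K_ideal n q d"
  interpret ideal "K_ideal n q d" "cfree n" by (rule ideal_K_ideal)
  have "0 \<in> K_ideal n q d"
    using additive_subgroup.zero_closed[OF is_additive_subgroup] by simp
  then show ?thesis
    using a_rcos_const[OF f] a_rcos_const by (simp add: cls_def)
qed

text \<open>
  Hence elements of \<open>H_alg\<close> have polynomial representatives without letters \<open>E\<close>, so that the infinite
  series of the completion do not enter in the comparison with \<open>\<rho>\<close>.
\<close>

lemma H_alg_eq: "H_alg n q d = cls n q d ` heis_poly n"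
proof
  interpret R: ring "K_alg n q d"
    unfolding K_alg_def by (rule ideal.quotient_is_ring[OF ideal_K_ideal])
  note hom = cls_hom[OF cfree_set_heis cfree_set_heis] cls_uminus[OF cfree_set_heis]
  show "H_alg n q d \<subseteq> cls n q d ` heis_poly n"
  proof
    fix x assume "x \<in> H_alg n q d"
    then show "x \<in> cls n q d ` heis_poly n"
      unfolding H_alg_def
    proof (induction rule: generate_ring.induct)
      case one
      then show ?case using cls_one heis_poly_one by (metis imageI)
    next
      case (incl x)
      then show ?case by (auto intro!: imageI heis_poly.scal heis_poly.letter)
    next
      case (a_inv x)
      then show ?case by (auto simp: hom(3)[symmetric] intro: heis_poly_uminus)
    next
      case (eng_add x y)
      then show ?case by (auto simp: hom(1)[symmetric] intro: heis_poly.add)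
    next
      case (eng_mult x y)
      then show ?case by (auto simp: hom(2)[symmetric] intro: heis_poly.mult)
    qed
  qed
  have "cls n q d f \<in> H_alg n q d" if "f \<in> heis_poly n" for f
    using that
  proof (induction rule: heis_poly.induct)
    case (scal c)
    then show ?case unfolding H_alg_def by (intro generate_ring.incl) auto
  next
    case (letter x)
    then show ?case unfolding H_alg_def by (cases x) (auto intro!: generate_ring.incl imageI)
  next
    case (add f g)
    then show ?case using hom(1)[OF add.hyps] unfolding H_alg_def by (simp add: generate_ring.eng_add)
  next
    case (mult f g)
    then show ?case using hom(2)[OF mult.hyps] unfolding H_alg_def by (simp add: generate_ring.eng_mult)
  qed
  then show "cls n q d ` heis_poly n \<subseteq> H_alg n q d" by blast
qed

section \<open>Series acting on a module bounded above\<close>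

text \<open>
  An assignment of operators of the correct degrees to single letters, on a graded space bounded above.
  Such an assignment extends to the whole completed free algebra, before any relation is imposed.
\<close>

locale letter_action = vector_space scale
  for scale :: "complex \<Rightarrow> 'v::ab_group_add \<Rightarrow> 'v" +
  fixes V :: "int \<Rightarrow> 'v set" and T :: "gen \<Rightarrow> 'v \<Rightarrow> 'v"
  assumes grading: "grading scale V" and bounded: "bounded_above V"
    and linear_T: "\<And>x. Vector_Spaces.linear scale scale (T x)"
    and degree_T: "\<And>x k v. v \<in> V k \<Longrightarrow> T x v \<in> V (gdeg x + k)"
begin

fun word_act :: "gen list \<Rightarrow> 'v \<Rightarrow> 'v" where
  "word_act [] v = v"
| "word_act (x # w) v = T x (word_act w v)"

text \<open>
  On each vector this is a finite sum when \<open>f\<close> lies in the completed free algebra, by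
  \<open>kills_from_exists\<close>.
\<close>

definition ser_act :: "ser \<Rightarrow> 'v \<Rightarrow> 'v" where
  "ser_act f v = (\<Sum>w | w \<in> supp f \<and> word_act w v \<noteq> 0. scale (coef f w) (word_act w v))"

lemma word_act_append: "word_act (u @ v) x = word_act u (word_act v x)"
  by (induction u) auto

lemma linear_word_act: "Vector_Spaces.linear scale scale (word_act w)"
proof (induction w)
  case Nil
  then show ?case by (simp add: Vector_Spaces.linear_iff vector_space_axioms)
next
  case (Cons x w)
  then show ?case using linear_T[of x] by (simp add: Vector_Spaces.linear_iff)
qed

lemma word_act_0 [simp]: "word_act w 0 = 0"
  and word_act_add: "word_act w (u + v) = word_act w u + word_act w v"
  and word_act_scale: "word_act w (scale c v) = scale c (word_act w v)"
  and word_act_sum: "word_act w (sum h S) = (\<Sum>s\<in>S. word_act w (h s))"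
proof -
  interpret l: Vector_Spaces.linear scale scale "word_act w" by (rule linear_word_act)
  show "word_act w 0 = 0" "word_act w (u + v) = word_act w u + word_act w v"
    "word_act w (scale c v) = scale c (word_act w v)"
    "word_act w (sum h S) = (\<Sum>s\<in>S. word_act w (h s))"
    by (fact l.zero l.add l.scale l.sum)+
qed

lemma degree_word_act: "v \<in> V k \<Longrightarrow> word_act w v \<in> V (wdeg w + k)"
  by (induction w) (use degree_T in \<open>force simp: add.assoc\<close>)+

definition kills_from :: "int \<Rightarrow> 'v \<Rightarrow> bool" where
  "kills_from m v \<longleftrightarrow> (\<forall>w. word_act w v \<noteq> 0 \<longrightarrow> suffixes_below m w)"

lemma kills_from_mono: "kills_from m v \<Longrightarrow> m \<le> m' \<Longrightarrow> kills_from m' v"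
  unfolding kills_from_def using suffixes_below_mono by blast

text \<open>
  If the components of \<open>v\<close> live in degrees at least \<open>l\<close> and \<open>V\<close> vanishes above degree \<open>N\<close>, then a suffix
  of degree more than \<open>N - l\<close> sends \<open>v\<close> to \<open>0\<close>, and so does the whole word.
\<close>

lemma kills_from_exists: "\<exists>m. kills_from m v"
proof -
  obtain N where N: "\<And>k. k > N \<Longrightarrow> V k = {0}"
    using bounded unfolding bounded_above_def by blast
  have "\<exists>!c. (\<forall>k. c k \<in> V k) \<and> finite {k. c k \<noteq> 0} \<and> v = (\<Sum>k | c k \<noteq> 0. c k)"
    using grading unfolding grading_def by blast
  then obtain c where c: "\<And>k. c k \<in> V k" "finite {k. c k \<noteq> 0}" "v = (\<Sum>k | c k \<noteq> 0. c k)"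
    by (elim ex1E conjE) blast
  obtain l where l: "\<And>k. c k \<noteq> 0 \<Longrightarrow> l \<le> k"
    using bdd_below_finite[OF c(2)] unfolding bdd_below_def by blast
  have "suffixes_below (N - l + 1) w" if "word_act w v \<noteq> 0" for w
    unfolding suffixes_below_iff
  proof (intro allI impI)
    fix s t assume w: "w = s @ t"
    show "wdeg t < N - l + 1"
    proof (rule ccontr)
      assume *: "\<not> wdeg t < N - l + 1"
      have "word_act t (c k) = 0" if "c k \<noteq> 0" for k
        using degree_word_act[OF c(1), of t k] N[of "wdeg t + k"] l[OF that] * by auto
      then have "word_act t v = 0"
        by (subst c(3)) (simp add: word_act_sum)
      then show False using that w by (simp add: word_act_append)
    qed
  qed
  then show ?thesis unfolding kills_from_def by blast
qed

lemma kills_from_finite: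
  assumes "finite S"
  shows "\<exists>m. \<forall>v\<in>S. kills_from m v"
  using assms
proof (induction S)
  case (insert v S)
  then obtain m where "\<forall>v\<in>S. kills_from m v" by blast
  moreover obtain m' where "kills_from m' v" using kills_from_exists by blast
  ultimately have "\<forall>v\<in>insert v S. kills_from (max m m') v"
    using kills_from_mono by (metis insert_iff max.cobounded1 max.cobounded2)
  then show ?case by blast
qed simp

lemma ser_act_eq_sum:
  assumes "finite S" "\<And>w. w \<in> supp f \<Longrightarrow> word_act w v \<noteq> 0 \<Longrightarrow> w \<in> S"
  shows "ser_act f v = (\<Sum>w\<in>S. scale (coef f w) (word_act w v))"
  unfolding ser_act_def
  by (rule sum.mono_neutral_left) (use assms in \<open>auto simp: supp_def\<close>)

lemma ser_act_cutoff:
  assumes "f \<in> cfree_set n" "kills_from m v"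
  shows "ser_act f v = (\<Sum>w | w \<in> supp f \<and> suffixes_below m w. scale (coef f w) (word_act w v))"
  by (rule ser_act_eq_sum)
    (use assms in \<open>auto simp: kills_from_def intro: cfree_set_finite\<close>)

lemma linear_ser_act:
  assumes f: "f \<in> cfree_set n"
  shows "Vector_Spaces.linear scale scale (ser_act f)"
  unfolding Vector_Spaces.linear_iff
proof (intro conjI allI)
  fix u v c
  obtain m where m: "\<forall>x\<in>{u, v, u + v, scale c v}. kills_from m x"
    using kills_from_finite[of "{u, v, u + v, scale c v}"] by auto
  show "ser_act f (u + v) = ser_act f u + ser_act f v"
    using m by (simp add: ser_act_cutoff[OF f, of m] word_act_add scale_right_distrib sum.distrib)
  show "ser_act f (scale c v) = scale c (ser_act f v)"
    using m by (simp add: ser_act_cutoff[OF f, of m] word_act_scale scale_sum_right mult.commute)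
qed (rule vector_space_axioms)+

lemma ser_act_add:
  assumes "f \<in> cfree_set n" "g \<in> cfree_set n"
  shows "ser_act (f + g) v = ser_act f v + ser_act g v"
proof -
  obtain m where m: "kills_from m v" using kills_from_exists by blast
  let ?S = "{w\<in>supp f. suffixes_below m w} \<union> {w\<in>supp g. suffixes_below m w}"
  have fin: "finite ?S" using assms by (auto intro: cfree_set_finite)
  have "ser_act h v = (\<Sum>w\<in>?S. scale (coef h w) (word_act w v))" if "supp h \<subseteq> supp f \<union> supp g" for h
    by (rule ser_act_eq_sum[OF fin]) (use that m in \<open>auto simp: kills_from_def\<close>)
  note eq = this
  show ?thesis
    by (simp add: eq supp_add scale_left_distrib sum.distrib)
qed

lemma ser_act_scal: "ser_act (scal c) v = scale c v"
proof -
  have "ser_act (scal c) v = (\<Sum>w\<in>{[]}. scale (coef (scal c) w) (word_act w v))"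
    by (rule ser_act_eq_sum) (use supp_scal in auto)
  then show ?thesis by (simp add: scal_def)
qed

lemma ser_act_letter: "ser_act (letter x) v = T x v"
proof -
  have "ser_act (letter x) v = (\<Sum>w\<in>{[x]}. scale (coef (letter x) w) (word_act w v))"
    by (rule ser_act_eq_sum) auto
  then show ?thesis by (simp add: letter_def)
qed

text \<open>
  Both sides are the sum of \<open>h (t, u)\<close> over the same finite rectangle of pairs of words: \<open>u\<close> ranges over
  the words of \<open>g\<close> below a cutoff for \<open>v\<close>, and \<open>t\<close> over the words of \<open>f\<close> below a common cutoff for the
  finitely many vectors \<open>word_act u v\<close>.  On the left side the pairs are grouped by their concatenation.
\<close>

lemma ser_act_mult:
  assumes f: "f \<in> cfree_set n" and g: "g \<in> cfree_set n"
  shows "ser_act (f * g) v = ser_act f (ser_act g v)"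
proof -
  obtain m where m: "kills_from m v" using kills_from_exists by blast
  define B where "B = {u\<in>supp g. suffixes_below m u}"
  have finB: "finite B" unfolding B_def by (rule cfree_set_finite[OF g])
  obtain m' where m': "\<And>u. u \<in> B \<Longrightarrow> kills_from m' (word_act u v)"
    using kills_from_finite[OF finite_imageI[OF finB], of "\<lambda>u. word_act u v"] by blast
  define A where "A = {t\<in>supp f. suffixes_below m' t}"
  have finA: "finite A" unfolding A_def by (rule cfree_set_finite[OF f])
  define h where "h = (\<lambda>(t, u). scale (coef f t * coef g u) (word_act (t @ u) v))"
  \<comment> \<open>the support of \<open>h\<close> lies in the finite rectangle, although \<open>h\<close> is defined on all pairs\<close>
  have h_nz: "p \<in> A \<times> B" if "h p \<noteq> 0" for p
  proof -
    obtain t u where p: "p = (t, u)" by (cases p)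
    have *: "t \<in> supp f" "u \<in> supp g" "word_act t (word_act u v) \<noteq> 0"
      using that by (auto simp: h_def p supp_def word_act_append)
    then have "word_act u v \<noteq> 0" by auto
    then have "u \<in> B" using * m by (auto simp: B_def kills_from_def)
    then show ?thesis using * m' by (auto simp: A_def p kills_from_def)
  qed
  interpret F: Vector_Spaces.linear scale scale "ser_act f" by (rule linear_ser_act[OF f])
  have "ser_act f (ser_act g v) = (\<Sum>u\<in>B. scale (coef g u) (ser_act f (word_act u v)))"
    by (simp add: ser_act_cutoff[OF g m] B_def F.sum F.scale)
  also have "\<dots> = (\<Sum>u\<in>B. \<Sum>t\<in>A. h (t, u))"
  proof (rule sum.cong[OF refl])
    fix u assume "u \<in> B"
    then show "scale (coef g u) (ser_act f (word_act u v)) = (\<Sum>t\<in>A. h (t, u))"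
      by (simp add: ser_act_cutoff[OF f m'] A_def h_def word_act_append scale_sum_right mult.commute)
  qed
  also have "\<dots> = (\<Sum>p\<in>A \<times> B. h p)"
    by (subst sum.swap) (simp add: sum.cartesian_product)
  finally have rhs: "ser_act f (ser_act g v) = (\<Sum>p\<in>A \<times> B. h p)" .
  define R where "R = (\<lambda>(t, u). t @ u) ` (A \<times> B)"
  have finR: "finite R" using finA finB by (simp add: R_def)
  have "ser_act (f * g) v = (\<Sum>w\<in>R. scale (coef (f * g) w) (word_act w v))"
  proof (rule ser_act_eq_sum[OF finR])
    fix w assume w: "w \<in> supp (f * g)" "word_act w v \<noteq> 0"
    then obtain t u where tu: "w = t @ u" "t \<in> supp f" "u \<in> supp g" by (elim supp_multE)
    then have "h (t, u) \<noteq> 0" using w by (simp add: h_def supp_def)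
    then show "w \<in> R" using h_nz tu by (auto simp: R_def)
  qed
  also have "\<dots> = (\<Sum>w\<in>R. \<Sum>k\<le>length w. h (take k w, drop k w))"
    by (simp add: coef_mult h_def scale_sum_left)
  also have "\<dots> = (\<Sum>(w, k)\<in>Sigma R (\<lambda>w. {..length w}). h (take k w, drop k w))"
    by (rule sum.Sigma) (use finR in auto)
  \<comment> \<open>a word with a chosen cutting position is the same as a pair of words\<close>
  also have "\<dots> = (\<Sum>p\<in>{p. fst p @ snd p \<in> R}. h p)"
    by (rule sum.reindex_bij_witness[where i = "\<lambda>(t, u). (t @ u, length t)"
          and j = "\<lambda>(w, k). (take k w, drop k w)"]) auto
  also have "\<dots> = (\<Sum>p\<in>A \<times> B. h p)"
  proof (rule sum.mono_neutral_right)
    have "{p. fst p @ snd p \<in> R} \<subseteq> (\<lambda>(w, k). (take k w, drop k w)) ` Sigma R (\<lambda>w. {..length w})"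
    proof
      fix p assume "p \<in> {p. fst p @ snd p \<in> R}"
      then show "p \<in> (\<lambda>(w, k). (take k w, drop k w)) ` Sigma R (\<lambda>w. {..length w})"
        by (intro image_eqI[of _ _ "(fst p @ snd p, length (fst p))"]) auto
    qed
    then show "finite {p. fst p @ snd p \<in> R}"
      by (rule finite_subset) (use finR in auto)
  qed (use h_nz in \<open>auto simp: R_def\<close>)
  finally show ?thesis using rhs by simp
qed

lemma ser_act_uminus: "f \<in> cfree_set n \<Longrightarrow> ser_act (- f) v = - ser_act f v"
  using ser_act_add[of f n "- f" v] ser_act_scal[of 0 v]
  by (simp add: cfree_set_uminus scal_0 eq_neg_iff_add_eq_0 add.commute)

lemma ser_act_diff:
  "f \<in> cfree_set n \<Longrightarrow> g \<in> cfree_set n \<Longrightarrow> ser_act (f - g) v = ser_act f v - ser_act g v"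
  using ser_act_add[of f n "- g" v] by (simp add: cfree_set_uminus ser_act_uminus)

lemma ser_act_nbhd: "kills_from m v \<Longrightarrow> f \<in> nbhd n m \<Longrightarrow> ser_act f v = 0"
  by (auto simp: ser_act_def nbhd_iff kills_from_def intro: sum.neutral)

lemma degree_ser_act:
  assumes "homog k f" "v \<in> V l"
  shows "ser_act f v \<in> V (k + l)"
  unfolding ser_act_def
proof (rule subspace_sum)
  show "subspace (V (k + l))" using grading by (simp add: grading_def)
  fix w assume "w \<in> {w. w \<in> supp f \<and> word_act w v \<noteq> 0}"
  then show "scale (coef f w) (word_act w v) \<in> V (k + l)"
    using degree_word_act[OF assms(2), of w] assms(1) grading
    by (auto simp: homog_def grading_def intro: subspace_scale)
qed

definition annihilator :: "nat \<Rightarrow> ser set" where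
  "annihilator n = {f \<in> cfree_set n. \<forall>v. ser_act f v = 0}"

text \<open>
  The kernel of the action is closed because each vector is killed by a whole neighbourhood of \<open>0\<close>.
\<close>

lemma closed_ideal_annihilator: "closed_ideal n (annihilator n)"
  unfolding closed_ideal_def
proof (intro conjI ballI impI)
  show "ideal (annihilator n) (cfree n)"
  proof (rule ideal_cfreeI)
    show "annihilator n \<subseteq> cfree_set n" by (auto simp: annihilator_def)
    show "0 \<in> annihilator n"
      using ser_act_scal[of 0] by (simp add: annihilator_def cfree_set_zero scal_0)
    show "f - g \<in> annihilator n" if "f \<in> annihilator n" "g \<in> annihilator n" for f g
      using that by (simp add: annihilator_def cfree_set_diff ser_act_diff[of f n g])
    fix f g assume f: "f \<in> annihilator n" and g: "g \<in> cfree_set n"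
    have "ser_act g 0 = 0" by (simp add: ser_act_def)
    then show "g * f \<in> annihilator n \<and> f * g \<in> annihilator n"
      using f g ser_act_mult[of g n f] ser_act_mult[of f n g]
      by (simp add: annihilator_def cfree_set_mult)
  qed
  fix f assume f: "f \<in> carrier (cfree n)" "\<forall>m. \<exists>g\<in>annihilator n. f - g \<in> nbhd n m"
  have "ser_act f v = 0" for v
  proof -
    obtain m where m: "kills_from m v" using kills_from_exists by blast
    obtain g where g: "g \<in> annihilator n" "f - g \<in> nbhd n m" using f(2) by blast
    then show ?thesis
      using ser_act_nbhd[OF m g(2)] f(1) ser_act_diff[of f n g v] by (simp add: annihilator_def)
  qed
  then show "f \<in> annihilator n" using f(1) by (simp add: annihilator_def)
qed

text \<open>
  Applied below to the letters \<open>E\<close>: a single vanishing letter anywhere in a word makes the word act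
  by \<open>0\<close>.
\<close>

lemma ser_act_eq_0_if_letter_kills:
  assumes "\<And>w. w \<in> supp f \<Longrightarrow> \<exists>x\<in>set w. \<forall>v. T x v = 0"
  shows "ser_act f v = 0"
proof -
  have "word_act w u = 0" if "x \<in> set w" "\<forall>v. T x v = 0" for w x u
    using that
  proof (induction w)
    case (Cons y w)
    then show ?case using word_act_0[of "[y]"] by (auto simp del: word_act_0)
  qed simp
  then show ?thesis using assms unfolding ser_act_def by (intro sum.neutral) blast
qed

lemma ser_act_Cpow:
  assumes "c \<noteq> 0" "\<And>v. T C v = scale c v" "\<And>v. T Cinv v = scale (inverse c) v"
  shows "ser_act (Cpow k) v = scale (c powi k) v"
proof -
  have pow: "ser_act (letter x ^ m) v = scale (a ^ m) v"
    if T: "\<And>v. T x v = scale a v" and x: "valid 0 x" for x a m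
  proof (induction m)
    case 0
    show ?case using ser_act_scal[of 1 v] by (simp add: scal_1)
  next
    case (Suc m)
    have "letter x ^ m \<in> cfree_set 0"
      by (induction m) (use x in \<open>auto intro: cfree_set_one cfree_set_mult cfree_set_letter\<close>)
    then have "ser_act (letter x * letter x ^ m) v = T x (ser_act (letter x ^ m) v)"
      by (simp add: ser_act_mult[OF cfree_set_letter[OF x]] ser_act_letter)
    then show ?case by (simp add: Suc T)
  qed
  show ?thesis
    using pow[of C c] pow[of Cinv "inverse c"] assms by (simp add: Cpow_def power_int_def)
qed

lemma ser_act_Cpow_mult:
  assumes "c \<noteq> 0" "\<And>v. T C v = scale c v" "\<And>v. T Cinv v = scale (inverse c) v"
    and "f \<in> cfree_set n"
  shows "ser_act (Cpow k * f) v = scale (c powi k) (ser_act f v)"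
  using ser_act_mult[OF cfree_set_heis[OF heis_poly_Cpow] assms(4)] ser_act_Cpow[OF assms(1-3)]
  by simp

end

section \<open>Series all of whose words contain a letter E\<close>

definition E_words :: "ser \<Rightarrow> bool" where
  "E_words f \<longleftrightarrow> (\<forall>w\<in>supp f. \<exists>i k. E i k \<in> set w)"

lemma E_words_Ecur: "E_words (Ecur i a)"
  by (simp add: E_words_def Ecur_def)

lemma E_words_add: "E_words f \<Longrightarrow> E_words g \<Longrightarrow> E_words (f + g)"
  and E_words_diff: "E_words f \<Longrightarrow> E_words g \<Longrightarrow> E_words (f - g)"
  using supp_add[of f g] supp_diff[of f g] by (auto simp: E_words_def)

lemma E_words_mult_left: "E_words f \<Longrightarrow> E_words (f * g)"
  and E_words_mult_right: "E_words g \<Longrightarrow> E_words (f * g)"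
  by (fastforce simp: E_words_def elim!: supp_multE)+

lemma E_words_fsum: "(\<And>b. E_words (F b)) \<Longrightarrow> E_words (fsum F)"
  using supp_fsum[of F] by (fastforce simp: E_words_def)

lemma E_words_delta_KEK: "E_words (delta_KEK q i j a b c)"
  unfolding delta_KEK_def
  by (intro E_words_fsum E_words_mult_left[OF E_words_mult_right] E_words_Ecur)

lemma E_words_serreR: "E_words (serreR q e i j a b c)"
  unfolding serreR_def by (intro E_words_add E_words_fsum E_words_mult_right E_words_delta_KEK)

lemma E_words_pcomm: "E_words f \<or> E_words g \<Longrightarrow> E_words (pcomm p f g)"
  by (auto simp: pcomm_def intro!: E_words_diff intro: E_words_mult_left E_words_mult_right)

lemma E_words_serreL: "E_words (serreL q i j a b c)"
  by (simp add: serreL_def E_words_pcomm E_words_Ecur)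

lemma E_words_Sym2: "(\<And>a b c. E_words (F a b c)) \<Longrightarrow> E_words (Sym2 F a b c)"
  by (simp add: Sym2_def E_words_add E_words_mult_right)

section \<open>Extension of a Heisenberg module by zero\<close>

locale heisenberg_module = vector_space scale
  for scale :: "complex \<Rightarrow> 'v::ab_group_add \<Rightarrow> 'v" +
  fixes n :: nat and q d :: complex and \<rho> :: "ser set \<Rightarrow> 'v \<Rightarrow> 'v" and V :: "int \<Rightarrow> 'v set"
  assumes q_nonzero: "q \<noteq> 0"
    and rep: "subalg_rep n q d scale (H_alg n q d) \<rho>"
    and level: "\<And>v. \<rho> (cls n q d (letter C)) v = scale (inverse q) v"
    and V_grading: "grading scale V" and V_graded: "graded_action n q d (H_alg n q d) \<rho> V"
    and V_bounded: "bounded_above V"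
begin

text \<open>
  The letters \<open>E\<close> act by zero, the Heisenberg letters through \<open>\<rho>\<close>.  Letters that are not valid generators
  do not occur in the completed free algebra and receive the value \<open>0\<close> for totality.
\<close>

definition T :: "gen \<Rightarrow> 'v \<Rightarrow> 'v" where
  "T x = (if valid n x \<and> (\<forall>i k. x \<noteq> E i k) then \<rho> (cls n q d (letter x)) else (\<lambda>_. 0))"

lemma T_E [simp]: "T (E i k) v = 0"
  by (simp add: T_def)

lemma cls_heis: "f \<in> heis_poly n \<Longrightarrow> cls n q d f \<in> H_alg n q d"
  by (simp add: H_alg_eq)

lemma cls_homog: "f \<in> cfree_set n \<Longrightarrow> homog k f \<Longrightarrow> cls n q d f \<in> K_deg n q d k"
  by (auto simp: K_deg_def homog_def)

lemma linear_T: "Vector_Spaces.linear scale scale (T x)"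
proof (cases "valid n x \<and> (\<forall>i k. x \<noteq> E i k)")
  case True
  then have "cls n q d (letter x) \<in> H_alg n q d" by (auto intro!: cls_heis heis_poly.letter)
  then show ?thesis using rep True by (simp add: T_def subalg_rep_def)
next
  case False
  then show ?thesis by (auto simp: T_def Vector_Spaces.linear_iff vector_space_axioms)
qed

lemma degree_T:
  assumes v: "v \<in> V k"
  shows "T x v \<in> V (gdeg x + k)"
proof (cases "valid n x \<and> (\<forall>i k. x \<noteq> E i k)")
  case True
  then have "cls n q d (letter x) \<in> H_alg n q d \<inter> K_deg n q d (gdeg x)"
    by (auto intro!: cls_heis heis_poly.letter cls_homog cfree_set_letter homog_letter)
  then show ?thesis using V_graded True v by (simp add: T_def graded_action_def)
next
  case False
  then show ?thesis using V_grading subspace_0 by (auto simp: T_def grading_def)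
qed

sublocale letter_action scale V T
  by (intro letter_action.intro letter_action_axioms.intro vector_space_axioms
      V_grading V_bounded linear_T degree_T)

text \<open>
  A polynomial is reached from the letters by finitely many sums and products, and both actions respect
  these.
\<close>

lemma ser_act_heis: "f \<in> heis_poly n \<Longrightarrow> ser_act f v = \<rho> (cls n q d f) v"
proof (induction f arbitrary: v rule: heis_poly.induct)
  case (scal c)
  then show ?case using rep by (simp add: ser_act_scal subalg_rep_def)
next
  case (letter x)
  then have "T x = \<rho> (cls n q d (letter x))" by (simp add: T_def)
  then show ?case by (simp add: ser_act_letter)
next
  case (add f g)
  then show ?case using rep cls_heis[OF add.hyps(1)] cls_heis[OF add.hyps(2)]
    by (simp add: ser_act_add[of f n g] cfree_set_heis cls_hom subalg_rep_def)
next
  case (mult f g)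
  then show ?case using rep cls_heis[OF mult.hyps(1)] cls_heis[OF mult.hyps(2)]
    by (simp add: ser_act_mult[of f n g] cfree_set_heis cls_hom subalg_rep_def)
qed

lemma ser_act_heis_relation:
  assumes "f \<in> rels n q d" "f \<in> heis_poly n"
  shows "ser_act f v = 0"
proof -
  have "cls n q d f = cls n q d 0" using assms(1) rels_subset_K_ideal cls_K_ideal by blast
  then have "ser_act f v = ser_act 0 v"
    using assms(2) heis_poly_zero by (simp add: ser_act_heis)
  then show ?thesis by (simp add: ser_act_def)
qed

lemma ser_act_E_words: "E_words f \<Longrightarrow> ser_act f v = 0"
  by (rule ser_act_eq_0_if_letter_kills) (use T_E in \<open>unfold E_words_def, blast\<close>)

lemma T_C: "T C v = scale (inverse q) v"
  by (simp add: T_def level)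

lemma T_Cinv: "T Cinv v = scale (inverse (inverse q)) v"
proof -
  have "ser_act (letter C * letter Cinv - 1) v = 0"
    by (intro ser_act_heis_relation rels.C_Cinv heis_poly_diff heis_poly.mult heis_poly.letter
        heis_poly_one) auto
  then have "T C (T Cinv v) = v"
    using ser_act_scal[of 1 v]
    by (simp add: ser_act_diff[of _ n] ser_act_mult[of _ n] ser_act_letter scal_1
        cfree_set_mult cfree_set_letter cfree_set_one)
  then have "scale q v = scale q (scale (inverse q) (T Cinv v))" by (simp add: T_C)
  then show ?thesis using q_nonzero by simp
qed

lemma ser_act_delta_KK:
  assumes "i < n"
  shows "ser_act (delta_KK1 q i a b) v = scale (inverse q powi (- 2 * b)) (ser_act (KK q i (a + b)) v)"
    and "ser_act (delta_KK2 q i a b) v = scale (inverse q powi (- 2 * a)) (ser_act (KK q i (a + b)) v)"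
  using ser_act_Cpow_mult[OF _ T_C T_Cinv cfree_set_KK[OF assms]] q_nonzero
  by (simp_all add: delta_KK1_def delta_KK2_def)

text \<open>
  This is where the value of \<open>C\<close> enters.  With $C = q^{-1}$ the coefficients of $z^a w^b$ in the two delta
  terms act by $q^{2b}$ and $q^{2a}$ times the same operator \<open>ser_act (KK q i (a + b))\<close>, and the
  factors $z - q^2 w$ and $w - q^2 z$ vanish on the supports $w = C^2 z$ and $z = C^2 w$ of the delta functions.
  In coefficients this is the identity \<open>shift\<close>.
\<close>

lemma ser_act_EE_rhs:
  assumes i: "i < n"
  shows "ser_act ((delta_KK1 q i (a - 1) b - scal (gpar n q d i i) * delta_KK1 q i a (b - 1))
              + (delta_KK2 q i a (b - 1) - scal (gpar n q d i i) * delta_KK2 q i (a - 1) b)) v = 0"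
proof -
  have shift: "q^2 * inverse q powi (- 2 * (k - 1)) = inverse q powi (- 2 * k)" for k
  proof -
    have "inverse q powi (- 2 * (k - 1)) = inverse q powi (- 2 * k) * inverse q powi 2"
      using q_nonzero by (subst power_int_add[symmetric]) (auto simp: algebra_simps)
    then show ?thesis using q_nonzero by (simp add: power_inverse)
  qed
  have mem: "delta_KK1 q i a b \<in> cfree_set n" "delta_KK2 q i a b \<in> cfree_set n" for a b
    unfolding delta_KK1_def delta_KK2_def
    by (intro cfree_set_mult cfree_set_heis[OF heis_poly_Cpow] cfree_set_KK i)+
  have "gpar n q d i i = q^2" by (simp add: gpar_def)
  moreover have sum_index: "a - 1 + b = a + (b - 1)" by simp
  \<comment> \<open>\<open>mult_minus_left\<close> would destroy the exponents \<open>- 2 * k\<close> that \<open>shift\<close> has to match\<close>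
  ultimately show ?thesis
    by (simp add: ser_act_add[of _ n] ser_act_diff[of _ n] ser_act_mult[of _ n] ser_act_scal
        cfree_set_add cfree_set_diff cfree_set_mult cfree_set_scal mem ser_act_delta_KK[OF i]
        shift sum_index del: mult_minus_left)
qed

text \<open>
  The relations among the Heisenberg currents hold because \<open>\<rho>\<close> is defined on the quotient, where they are
  zero, and \<open>C\<close> commutes with all letters because it acts by a scalar.  In the remaining ones each word
  contains a letter \<open>E\<close>, except for the right side of the \<open>E\<close>-\<open>E\<close> relation with \<open>i = j\<close>.
\<close>

lemma rels_annihilate:
  assumes "f \<in> rels n q d"
  shows "ser_act f v = 0"
  using assms
proof cases
  case C_Cinv
  show ?thesis by (rule ser_act_heis_relation[OF assms])
    (auto simp: C_Cinv intro!: heis_poly_diff heis_poly.mult heis_poly.letter heis_poly_one)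
next
  case Cinv_C
  show ?thesis by (rule ser_act_heis_relation[OF assms])
    (auto simp: Cinv_C intro!: heis_poly_diff heis_poly.mult heis_poly.letter heis_poly_one)
next
  case (C_central x)
  have "T x (scale c v) = scale c (T x v)" for c
    using word_act_scale[of "[x]" c v] by simp
  then show ?thesis
    using C_central by (simp add: ser_act_diff[of _ n] ser_act_mult[of _ n] ser_act_letter T_C
        cfree_set_mult cfree_set_letter)
next
  case (KpKp i j a b)
  show ?thesis by (rule ser_act_heis_relation[OF assms])
    (use KpKp in \<open>auto intro!: heis_poly_diff heis_poly.mult heis_poly_Kp\<close>)
next
  case (KmKm i j a b)
  show ?thesis by (rule ser_act_heis_relation[OF assms])
    (use KmKm in \<open>auto intro!: heis_poly_diff heis_poly.mult heis_poly_Km\<close>)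
next
  case (KpKm i j a b)
  show ?thesis by (rule ser_act_heis_relation[OF assms])
    (use KpKm in \<open>auto simp: fsum_KpKm intro!: heis_poly_diff heis_poly.mult heis_poly_sum
      heis_poly_Kp heis_poly_Km heis_poly_GGcoef\<close>)
next
  case (KpE i j a b)
  then show ?thesis
    by (auto intro!: ser_act_E_words E_words_diff E_words_fsum
        intro: E_words_mult_left E_words_mult_right E_words_Ecur)
next
  case (EKm i j b a)
  then show ?thesis
    by (auto intro!: ser_act_E_words E_words_diff E_words_fsum
        intro: E_words_mult_left E_words_mult_right E_words_Ecur)
next
  case (EE i j a b)
  let ?P = "scal (dpar n d i j)
        * (Ecur i (a - 1) * Ecur j b - scal (gpar n q d i j) * Ecur i a * Ecur j (b - 1))
      + (Ecur j (b - 1) * Ecur i a - scal (gpar n q d j i) * Ecur j b * Ecur i (a - 1))"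
  let ?D = "(delta_KK1 q i (a - 1) b - scal (gpar n q d i i) * delta_KK1 q i a (b - 1))
              + (delta_KK2 q i a (b - 1) - scal (gpar n q d i i) * delta_KK2 q i (a - 1) b)"
  let ?R = "if i = j then scal (1 / (q - inverse q)) * ?D else 0"
  have E: "ser_act ?P v = 0"
    by (intro ser_act_E_words E_words_add E_words_diff E_words_mult_right E_words_Ecur)
  have P: "?P \<in> cfree_set n"
    by (intro cfree_set_add cfree_set_diff cfree_set_mult cfree_set_scal
        poly_set_cfree[OF poly_set_Ecur] EE)
  have D: "?D \<in> cfree_set n"
    unfolding delta_KK1_def delta_KK2_def
    by (intro cfree_set_add cfree_set_diff cfree_set_mult cfree_set_scal
        cfree_set_heis[OF heis_poly_Cpow] cfree_set_KK EE)
  have "ser_act ?R v = 0"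
  proof (cases "i = j")
    case True
    then have "ser_act ?R v = ser_act (scal (1 / (q - inverse q))) (ser_act ?D v)"
      using ser_act_mult[OF cfree_set_scal D] by simp
    then show ?thesis using ser_act_EE_rhs[OF EE(2)] by (simp add: ser_act_scal)
  qed (simp add: ser_act_def)
  moreover have "?R \<in> cfree_set n"
    using D by (auto intro: cfree_set_mult cfree_set_scal cfree_set_zero)
  ultimately show ?thesis
    using ser_act_diff[OF P, of ?R v] E unfolding EE(1) by simp
next
  case (EE_far i j a b)
  show ?thesis
    unfolding EE_far(1) by (intro ser_act_E_words E_words_diff E_words_mult_right E_words_Ecur)
next
  case (Serre_up i j a b c)
  show ?thesis
    unfolding Serre_up(1)
    by (intro ser_act_E_words E_words_add E_words_Sym2 E_words_serreL E_words_serreR)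
next
  case (Serre_down j i a b c)
  show ?thesis
    unfolding Serre_down(1)
    by (intro ser_act_E_words E_words_add E_words_Sym2 E_words_serreL E_words_serreR)
qed

lemma ser_act_K_ideal: "f \<in> K_ideal n q d \<Longrightarrow> ser_act f v = 0"
  using K_ideal_least[OF closed_ideal_annihilator] rels_annihilate rels_subset_cfree
  by (fastforce simp: annihilator_def)

text \<open>
  By \<open>ser_act_K_ideal\<close> the choice of the representative is immaterial; see \<open>extended_action_cls\<close>.
\<close>

definition extended_action :: "ser set \<Rightarrow> 'v \<Rightarrow> 'v" where
  "extended_action x = ser_act (SOME f. f \<in> cfree_set n \<and> cls n q d f = x)"

lemma extended_action_cls:
  assumes f: "f \<in> cfree_set n"
  shows "extended_action (cls n q d f) v = ser_act f v"
proof -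
  define g where "g = (SOME g. g \<in> cfree_set n \<and> cls n q d g = cls n q d f)"
  have g: "g \<in> cfree_set n \<and> cls n q d g = cls n q d f"
    unfolding g_def by (rule someI[of _ f]) (use f in simp)
  then have "ser_act (g - f) v = 0"
    by (intro ser_act_K_ideal cls_eqD) (use f in auto)
  then have "ser_act g v = ser_act f v"
    using ser_act_diff[of g n f v] f g by simp
  then show ?thesis by (simp add: extended_action_def g_def)
qed

lemma K_module_extended_action: "K_module n q d scale extended_action"
  unfolding K_module_def
proof (intro conjI allI)
  have "extended_action (cls n q d f) = ser_act f" if "f \<in> cfree_set n" for f
    using extended_action_cls[OF that] by blast
  then show "subalg_rep n q d scale (carrier (K_alg n q d)) extended_action"
    unfolding subalg_rep_def
    by (auto simp: carrier_K_alg linear_ser_act cls_hom[symmetric] cfree_set_add cfree_set_mult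
        cfree_set_scal ser_act_scal ser_act_add[of _ n] ser_act_mult[of _ n])
  fix v
  obtain m where "kills_from m v" using kills_from_exists by blast
  then have "\<forall>f\<in>nbhd n m. extended_action (cls n q d f) v = 0"
    using extended_action_cls ser_act_nbhd by (metis nbhd_iff)
  then show "\<exists>m. \<forall>f\<in>nbhd n m. extended_action (cls n q d f) v = 0" by blast
qed

lemma extended_action_E: "i < n \<Longrightarrow> extended_action (cls n q d (letter (E i k))) v = 0"
  by (simp add: extended_action_cls cfree_set_letter ser_act_letter)

lemma extended_action_H_alg: "x \<in> H_alg n q d \<Longrightarrow> extended_action x = \<rho> x"
  by (auto simp: H_alg_eq extended_action_cls cfree_set_heis ser_act_heis)

lemma graded_action_extended_action: "graded_action n q d (carrier (K_alg n q d)) extended_action V"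
  unfolding graded_action_def
proof (intro allI ballI)
  fix k l x v
  assume "x \<in> carrier (K_alg n q d) \<inter> K_deg n q d k" and v: "v \<in> V l"
  then obtain f where "x = cls n q d f" "f \<in> cfree_set n" "homog k f"
    by (auto simp: K_deg_def homog_def)
  then show "extended_action x v \<in> V (k + l)"
    using degree_ser_act v by (simp add: extended_action_cls)
qed

lemma diagonalizable_C: "diagonalizable scale (extended_action (cls n q d (letter C)))"
proof -
  have "{v. \<exists>c. extended_action (cls n q d (letter C)) v = scale c v} = UNIV"
    by (auto simp: extended_action_cls cfree_set_letter ser_act_letter T_C)
  then show ?thesis by (simp add: diagonalizable_def)
qed

end

theorem lemma3p5:
  fixes n :: nat and qh dh q d :: complex
    and scale :: "complex \<Rightarrow> 'v::ab_group_add \<Rightarrow> 'v"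
    and \<rho> :: "ser set \<Rightarrow> 'v \<Rightarrow> 'v"
    and V :: "int \<Rightarrow> 'v set"
  assumes n: "n \<ge> 3"
    and params: "qh \<noteq> 0" "dh \<noteq> 0" "q = qh^2" "d = dh^2"
    and generic: "\<And>i j :: int. (inverse q * d) powi i * (q^2) powi j = 1 \<Longrightarrow> i = 0 \<and> j = 0"
    and vs: "vector_space scale"
    and rep: "subalg_rep n q d scale (H_alg n q d) \<rho>"
    and irred: "irreducible_rep scale (H_alg n q d) \<rho>"
    and level: "\<And>v. \<rho> (cls n q d (letter C)) v = scale (inverse q) v"
    and graded: "grading scale V" "graded_action n q d (H_alg n q d) \<rho> V" "bounded_above V"
  shows "\<exists>\<sigma>. K_module n q d scale \<sigma> \<and>
      (\<forall>i<n. \<forall>k v. \<sigma> (cls n q d (letter (E i k))) v = 0) \<and>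
      (\<forall>x\<in>H_alg n q d. \<sigma> x = \<rho> x) \<and>
      graded_action n q d (carrier (K_alg n q d)) \<sigma> V \<and>
      ((\<forall>k. fin_dim scale (V k)) \<longrightarrow> admissible n q d scale \<sigma>)"
proof -
  interpret vector_space scale by (rule vs)
  interpret heisenberg_module scale n q d \<rho> V
    by unfold_locales (use params rep level graded in simp_all)
  have "(\<forall>k. fin_dim scale (V k)) \<longrightarrow> admissible n q d scale extended_action"
    using K_module_extended_action diagonalizable_C graded(1,3) graded_action_extended_action
    unfolding admissible_def by blast
  then show ?thesis
    using K_module_extended_action extended_action_E extended_action_H_alg graded_action_extended_action by blast
qed

end
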